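(* Fix integers $d\ge n\ge 3$ and let $W\subset\mathbb{P}^n$ be a quadric hypersurface of rank $\rho\ge 4$. Then there is a degree $d$ bamboo $T\subset\mathbb{P}^n$ intersecting $W$ transversally such that the finite set $T\cap W$ has maximal rank in $W$, i.e. for every integer $t$ the restriction map $H^0(\mathcal{O}_W(t))\to H^0(\mathcal{O}_{T\cap W}(t))$ is injective or surjective.
   Context: A degree $d$ tree $T\subset\mathbb{P}^n$ is a connected nodal curve of degree $d$ and arithmetic genus $0$ all of whose irreducible components are lines. A degree $d$ bamboo is a degree $d$ tree which is either a line ($d=1$) or, for $d\ge2$, admits an ordering $L_1,\dots,L_d$ of its components with $L_i\cap L_j\neq\emptyset$ if and only if $|i-j|\le 1$ (a chain of lines). *)

theory Defs
  imports "HOL-Analysis.Analysis"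
begin

text \<open>Projective space P^n over the complex numbers is modelled through affine cones in
  complex^'n with CARD('n) = n + 1.  A projective subvariety is represented by its affine
  cone (a set of vectors closed under scalar multiplication, containing 0).\<close>

definition proj_line :: "(complex^'n) set \<Rightarrow> bool" where
  "proj_line L \<longleftrightarrow> (\<exists>u v. (\<forall>a b. a *s u + b *s v = 0 \<longrightarrow> a = 0 \<and> b = 0) \<and>
                      L = {a *s u + b *s v | a b. True})"

definition proj_meet :: "(complex^'n) set \<Rightarrow> (complex^'n) set \<Rightarrow> bool" where
  "proj_meet A B \<longleftrightarrow> (\<exists>x. x \<noteq> 0 \<and> x \<in> A \<and> x \<in> B)"

text \<open>A degree d bamboo: d distinct lines L 0, ..., L (d-1) with L i meeting L j iff |i-j| \<le> 1.
  (Such a chain is automatically a connected nodal curve of arithmetic genus 0, i.e. a tree.)\<close>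
definition bamboo :: "nat \<Rightarrow> (nat \<Rightarrow> (complex^'n) set) \<Rightarrow> bool" where
  "bamboo d L \<longleftrightarrow> d \<ge> 1 \<and> (\<forall>i<d. proj_line (L i)) \<and> inj_on L {..<d} \<and>
     (\<forall>i<d. \<forall>j<d. proj_meet (L i) (L j) \<longleftrightarrow> (i \<le> j + 1 \<and> j \<le> i + 1))"

definition curve_of :: "nat \<Rightarrow> (nat \<Rightarrow> (complex^'n) set) \<Rightarrow> (complex^'n) set" where
  "curve_of d L = (\<Union>i<d. L i)"

definition qform :: "complex^'n^'n \<Rightarrow> complex^'n \<Rightarrow> complex" where
  "qform A x = (\<Sum>i\<in>UNIV. \<Sum>j\<in>UNIV. A$i$j * x$i * x$j)"

definition bform :: "complex^'n^'n \<Rightarrow> complex^'n \<Rightarrow> complex^'n \<Rightarrow> complex" where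
  "bform A x y = (\<Sum>i\<in>UNIV. \<Sum>j\<in>UNIV. A$i$j * x$i * y$j)"

definition quadric_of_rank :: "complex^'n^'n \<Rightarrow> nat \<Rightarrow> bool" where
  "quadric_of_rank A rho \<longleftrightarrow> transpose A = A \<and> rank A = rho"

definition quadric_cone :: "complex^'n^'n \<Rightarrow> (complex^'n) set" where
  "quadric_cone A = {x. qform A x = 0}"

text \<open>T (the bamboo given by the lines L 0..L (d-1)) meets W = V(q_A) transversally:
  at every point p of T \<inter> W, p is a smooth point of T (lies on exactly one line L i) and the
  tangent line L i of T at p is not contained in the tangent hyperplane {v. B(p,v) = 0} of W at p
  (this forces p to be a smooth point of W and no line to lie in W).\<close>
definition transversal :: "complex^'n^'n \<Rightarrow> nat \<Rightarrow> (nat \<Rightarrow> (complex^'n) set) \<Rightarrow> bool" where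
  "transversal A d L \<longleftrightarrow>
     (\<forall>i<d. \<forall>p \<in> L i. p \<noteq> 0 \<and> qform A p = 0 \<longrightarrow>
        (\<forall>j<d. j \<noteq> i \<longrightarrow> p \<notin> L j) \<and> (\<exists>v \<in> L i. bform A p v \<noteq> 0))"

text \<open>Homogeneous forms of degree t (t an integer; for t < 0 only the zero form),
  as polynomial functions on complex^'n.\<close>
definition hom_form :: "int \<Rightarrow> (complex^'n \<Rightarrow> complex) \<Rightarrow> bool" where
  "hom_form t f \<longleftrightarrow> (\<exists>c :: ('n \<Rightarrow> nat) \<Rightarrow> complex.
      f = (\<lambda>x. \<Sum>\<alpha>\<in>{\<alpha>::'n\<Rightarrow>nat. int (sum \<alpha> UNIV) = t}. c \<alpha> * (\<Prod>i\<in>UNIV. (x$i) ^ \<alpha> i)))"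

definition representatives :: "(complex^'n) set \<Rightarrow> (complex^'n) set \<Rightarrow> bool" where
  "representatives X S \<longleftrightarrow> S \<subseteq> X - {0} \<and>
     (\<forall>x \<in> X - {0}. \<exists>!s \<in> S. \<exists>c::complex. x = c *s s)"

text \<open>The finite set Z (cone Z) has maximal rank in the quadric W = V(q_A): for every integer t the
  restriction H^0(O_W(t)) \<rightarrow> H^0(O_Z(t)) is injective or surjective.  Here H^0(O_W(t)) is the
  space of degree t forms restricted to W (W is projectively normal), and H^0(O_Z(t)) is identified
  with functions on a set of representatives of the points of Z.\<close>
definition max_rank_in_quadric :: "complex^'n^'n \<Rightarrow> (complex^'n) set \<Rightarrow> bool" where
  "max_rank_in_quadric A Z \<longleftrightarrow> (\<forall>t::int.
      (\<forall>f. hom_form t f \<longrightarrow> (\<forall>p\<in>Z. f p = 0) \<longrightarrow> (\<forall>x \<in> quadric_cone A. f x = 0))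
    \<or> (\<forall>S. representatives Z S \<longrightarrow>
         (\<forall>g :: complex^'n \<Rightarrow> complex. \<exists>f. hom_form t f \<and> (\<forall>s\<in>S. f s = g s))))"

end

theory Submission
  imports Defs "HOL-Computational_Algebra.Polynomial"
begin

text \<open>A chain of lines is encoded by a starting point and, for each line, one of its two points on the
  quadric \<open>W\<close> together with the position of the next node; the second point on \<open>W\<close> is then obtained
  by the reflection of the quadratic form along the node. All these data depend polynomially on
  free parameters, and being independent for forms of degree \<open>t\<close> is a Zariski open condition, so
  that for each \<open>t\<close> it suffices to find one, possibly degenerate, chain.

  If all lines pass through one point \<open>u\<close> and span the space, the points on \<open>W\<close> are independent for
  \<open>t \<ge> 2\<close>. A longer chain is obtained by inserting a line at one of the nodes \<open>u\<close>. If none of these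
  insertions imposes two new conditions, then the quotient \<open>f / g\<close> of any two forms vanishing on the
  old points is invariant on \<open>W\<close> under the reflections along all nodes and along all points of the
  last line. The vectors whose reflection leaves \<open>f / g\<close> invariant are closed under reflecting one
  along another, which forces them to fill the whole space as soon as the nodes span it. As
  reflections exchange any two general points of \<open>W\<close>, the quotient is constant.\<close>

section \<open>Polynomial curves and polynomial functions\<close>

text \<open>A line added at a node \<open>u\<close> brings in the points \<open>x\<close> and
  \<open>refl u x\<close> of the quadric. They impose two new conditions as soon as
  \<open>f x * g (refl u x) - f (refl u x) * g x\<close> is nonzero for some \<open>f\<close>,
  \<open>g\<close> vanishing on the old points; if this 2 by 2 determinant is zero for all
  \<open>x\<close>, the ratio \<open>f / g\<close> is invariant. Two suitable forms exist as long as
  the quadric carries two more independent points than the chain has. The closure argument needs a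
  two-dimensional space of reflections to start from. It comes from the last node, which slides
  along the last line without moving any intersection point. In a degree with too few forms,
  independence of all \<open>2 * d\<close> points is impossible. It is replaced by independence of
  as many of them as the quadric allows: this is still an open condition, and it forces injectivity.
  Finally one chain must serve all degrees. In large degrees it suffices to separate pairs of points
  by quadrics, so only finitely many open conditions remain; degrees below 2 are settled
  directly.\<close>

definition cpoly :: "(complex \<Rightarrow> complex) \<Rightarrow> bool" where
  "cpoly \<phi> \<longleftrightarrow> (\<exists>p. \<phi> = poly p)"

definition pcurve :: "(complex \<Rightarrow> complex^'n) \<Rightarrow> bool" where
  "pcurve \<gamma> \<longleftrightarrow> (\<forall>i. cpoly (\<lambda>s. \<gamma> s $ i))"

text \<open>Later arguments restrict to a curve, where a nonzero polynomial has finitely many zeros;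
  no more is kept of polynomiality in several variables.\<close>

definition polyfun :: "(complex^'n \<Rightarrow> complex) \<Rightarrow> bool" where
  "polyfun \<phi> \<longleftrightarrow> (\<forall>\<gamma>. pcurve \<gamma> \<longrightarrow> cpoly (\<lambda>s. \<phi> (\<gamma> s)))"

named_theorems poly_intros

lemma cpoly_const [poly_intros]: "cpoly (\<lambda>s. c)"
  unfolding cpoly_def by (rule exI[of _ "[:c:]"]) auto

lemma cpoly_id [poly_intros]: "cpoly (\<lambda>s. s)"
  unfolding cpoly_def by (rule exI[of _ "[:0,1:]"]) auto

lemma cpoly_add [poly_intros]: "cpoly f \<Longrightarrow> cpoly g \<Longrightarrow> cpoly (\<lambda>s. f s + g s)"
  unfolding cpoly_def fun_eq_iff by (metis poly_add)

lemma cpoly_mult [poly_intros]: "cpoly f \<Longrightarrow> cpoly g \<Longrightarrow> cpoly (\<lambda>s. f s * g s)"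
  unfolding cpoly_def fun_eq_iff by (metis poly_mult)

lemma cpoly_diff [poly_intros]: "cpoly f \<Longrightarrow> cpoly g \<Longrightarrow> cpoly (\<lambda>s. f s - g s)"
  unfolding cpoly_def fun_eq_iff by (metis poly_diff)

lemma cpoly_power [poly_intros]: "cpoly f \<Longrightarrow> cpoly (\<lambda>s. f s ^ n)"
  by (induction n) (auto intro: poly_intros)

lemma cpoly_sum [poly_intros]: "(\<And>i. i \<in> I \<Longrightarrow> cpoly (f i)) \<Longrightarrow> cpoly (\<lambda>s. \<Sum>i\<in>I. f i s)"
  by (induction I rule: infinite_finite_induct) (auto intro: poly_intros)

lemma cpoly_prod [poly_intros]: "(\<And>i. i \<in> I \<Longrightarrow> cpoly (f i)) \<Longrightarrow> cpoly (\<lambda>s. \<Prod>i\<in>I. f i s)"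
  by (induction I rule: infinite_finite_induct) (auto intro: poly_intros)

lemma cpoly_finite_zeros:
  assumes "cpoly \<phi>" "\<phi> s0 \<noteq> 0" shows "finite {s. \<phi> s = 0}"
proof -
  obtain p where p: "\<phi> = poly p" using assms(1) unfolding cpoly_def by blast
  then have "p \<noteq> 0" using assms(2) by auto
  then show ?thesis using poly_roots_finite p by auto
qed

lemma cpoly_eq_0:
  assumes "cpoly \<phi>" "finite {s. \<phi> s \<noteq> 0}" shows "\<phi> s = 0"
proof (rule ccontr)
  assume "\<phi> s \<noteq> 0"
  then have "finite {s. \<phi> s = 0}" using cpoly_finite_zeros[OF assms(1)] by blast
  then have "finite ({s. \<phi> s = 0} \<union> {s. \<phi> s \<noteq> 0})" using assms(2) by blast
  moreover have "{s. \<phi> s = 0} \<union> {s. \<phi> s \<noteq> 0} = UNIV" by auto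
  ultimately show False using infinite_UNIV_char_0 by metis
qed

lemma cpoly_common_nonzero:
  assumes "cpoly \<phi>" "\<phi> s0 \<noteq> 0" "cpoly \<theta>" "\<theta> s1 \<noteq> 0" shows "\<exists>s. \<phi> s \<noteq> 0 \<and> \<theta> s \<noteq> 0"
proof (rule ccontr)
  assume "\<not> ?thesis"
  then have "{s. \<phi> s = 0} \<union> {s. \<theta> s = 0} = UNIV" by auto
  then have "finite (UNIV :: complex set)"
    using cpoly_finite_zeros[OF assms(1,2)] cpoly_finite_zeros[OF assms(3,4)] by (metis finite_UnI)
  then show False using infinite_UNIV_char_0 by blast
qed

lemma cofinite_complex_ex: "finite {s. \<not> P s} \<Longrightarrow> \<exists>s::complex. P s"
  using infinite_UNIV_char_0[where 'a=complex] by (metis (mono_tags, lifting) UNIV_eq_I mem_Collect_eq)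

lemma pcurve_nth [poly_intros]: "pcurve \<gamma> \<Longrightarrow> cpoly (\<lambda>s. \<gamma> s $ i)"
  by (auto simp: pcurve_def)

lemma pcurve_const [poly_intros]: "pcurve (\<lambda>s. v)"
  by (auto simp: pcurve_def intro: poly_intros)

lemma pcurve_add [poly_intros]: "pcurve f \<Longrightarrow> pcurve g \<Longrightarrow> pcurve (\<lambda>s. f s + g s)"
  by (auto simp: pcurve_def intro: poly_intros)

lemma pcurve_diff [poly_intros]: "pcurve f \<Longrightarrow> pcurve g \<Longrightarrow> pcurve (\<lambda>s. f s - g s)"
  by (auto simp: pcurve_def intro: poly_intros)

lemma pcurve_scale [poly_intros]: "cpoly c \<Longrightarrow> pcurve g \<Longrightarrow> pcurve (\<lambda>s. c s *s g s)"
  by (auto simp: pcurve_def intro: poly_intros)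

lemma polyfun_comp: "polyfun \<phi> \<Longrightarrow> pcurve \<gamma> \<Longrightarrow> cpoly (\<lambda>s. \<phi> (\<gamma> s))"
  by (auto simp: polyfun_def)

lemma polyfunI: "(\<And>\<gamma>. pcurve \<gamma> \<Longrightarrow> cpoly (\<lambda>s. \<phi> (\<gamma> s))) \<Longrightarrow> polyfun \<phi>"
  by (auto simp: polyfun_def)

section \<open>Homogeneous forms\<close>

definition form :: "nat \<Rightarrow> (complex^'n \<Rightarrow> complex) \<Rightarrow> bool" where
  "form t = hom_form (int t)"

definition mon :: "('n \<Rightarrow> nat) \<Rightarrow> complex^'n \<Rightarrow> complex" where
  "mon \<alpha> x = (\<Prod>i\<in>UNIV. (x$i) ^ \<alpha> i)"

definition exps :: "nat \<Rightarrow> ('n::finite \<Rightarrow> nat) set" where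
  "exps t = {\<alpha>. sum \<alpha> UNIV = t}"

lemma form_iff: "form t f \<longleftrightarrow> (\<exists>c. f = (\<lambda>x. \<Sum>\<alpha>\<in>exps t. c \<alpha> * mon \<alpha> x))"
  by (simp add: form_def hom_form_def mon_def exps_def del: of_nat_sum flip: of_nat_sum)

lemma finite_exps: "finite (exps t :: ('n::finite \<Rightarrow> nat) set)"
proof (rule finite_subset)
  show "exps t \<subseteq> {\<alpha>::'n \<Rightarrow> nat. \<forall>i. (i \<in> UNIV \<longrightarrow> \<alpha> i \<in> {..t}) \<and> (i \<notin> UNIV \<longrightarrow> \<alpha> i = 0)}"
    by (auto simp: exps_def intro: member_le_sum)
  show "finite {\<alpha>::'n \<Rightarrow> nat. \<forall>i. (i \<in> UNIV \<longrightarrow> \<alpha> i \<in> {..t}) \<and> (i \<notin> UNIV \<longrightarrow> \<alpha> i = 0)}"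
    by (rule finite_set_of_finite_funs) auto
qed

lemma mon_add: "mon (\<lambda>i. \<alpha> i + \<beta> i) x = mon \<alpha> x * mon \<beta> x"
  by (simp add: mon_def power_add prod.distrib)

lemma form_mon: "\<alpha> \<in> exps t \<Longrightarrow> form t (mon \<alpha>)"
  unfolding form_iff
  by (intro exI[of _ "\<lambda>\<beta>. if \<beta> = \<alpha> then 1 else 0"] ext)
     (simp add: if_distrib[of "\<lambda>c. c * _"] finite_exps cong: if_cong)

lemma form_scale: "form t f \<Longrightarrow> form t (\<lambda>x. c * f x)"
proof -
  assume "form t f"
  then obtain a where "f = (\<lambda>x. \<Sum>\<alpha>\<in>exps t. a \<alpha> * mon \<alpha> x)" unfolding form_iff by blast
  then show ?thesis unfolding form_iff
    by (intro exI[of _ "\<lambda>\<alpha>. c * a \<alpha>"]) (simp add: sum_distrib_left mult.assoc)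
qed

lemma form_add: "form t f \<Longrightarrow> form t g \<Longrightarrow> form t (\<lambda>x. f x + g x)"
proof -
  assume "form t f" "form t g"
  then obtain a b where "f = (\<lambda>x. \<Sum>\<alpha>\<in>exps t. a \<alpha> * mon \<alpha> x)"
     "g = (\<lambda>x. \<Sum>\<alpha>\<in>exps t. b \<alpha> * mon \<alpha> x)" unfolding form_iff by blast
  then show ?thesis unfolding form_iff
    by (intro exI[of _ "\<lambda>\<alpha>. a \<alpha> + b \<alpha>"]) (simp add: sum.distrib distrib_right)
qed

lemma form_0: "form t (\<lambda>x. 0)"
  unfolding form_iff by (rule exI[of _ "\<lambda>_. 0"]) simp

lemma form_diff: "form t f \<Longrightarrow> form t g \<Longrightarrow> form t (\<lambda>x. f x - g x)"
  using form_add[of t f "\<lambda>x. (-1) * g x"] form_scale[of t g "-1"] by simp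

lemma form_sum: "(\<And>i. i \<in> I \<Longrightarrow> form t (f i)) \<Longrightarrow> form t (\<lambda>x. \<Sum>i\<in>I. f i x)"
  by (induction I rule: infinite_finite_induct) (auto intro: form_0 form_add)

lemma form_mult:
  assumes "form s f" "form t g" shows "form (s + t) (\<lambda>x. f x * g x)"
proof -
  obtain a b where f: "f = (\<lambda>x. \<Sum>\<alpha>\<in>exps s. a \<alpha> * mon \<alpha> x)"
     and g: "g = (\<lambda>x. \<Sum>\<alpha>\<in>exps t. b \<alpha> * mon \<alpha> x)" using assms unfolding form_iff by blast
  have "(\<lambda>x. f x * g x) = (\<lambda>x. \<Sum>\<alpha>\<in>exps s. \<Sum>\<beta>\<in>exps t. (a \<alpha> * b \<beta>) * mon (\<lambda>i. \<alpha> i + \<beta> i) x)"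
    unfolding f g sum_product mon_add by (simp add: mult_ac)
  moreover have "form (s + t) (mon (\<lambda>i. \<alpha> i + \<beta> i))" if "\<alpha> \<in> exps s" "\<beta> \<in> exps t" for \<alpha> \<beta> :: "'a \<Rightarrow> nat"
    using that by (intro form_mon) (simp add: exps_def sum.distrib)
  ultimately show ?thesis by (simp add: form_sum form_scale)
qed

lemma form_const: "form 0 (\<lambda>x. c)"
proof -
  have "exps 0 = {\<lambda>i::'a. 0::nat}" by (auto simp: exps_def)
  then show ?thesis unfolding form_iff by (intro exI[of _ "\<lambda>_. c"]) (simp add: mon_def)
qed

lemma form_prod:
  assumes "finite I" "\<And>i. i \<in> I \<Longrightarrow> form t (f i)"
  shows "form (card I * t) (\<lambda>x. \<Prod>i\<in>I. f i x)"
  using assms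
proof (induction I rule: finite_induct)
  case empty
  then show ?case using form_const[of 1] by simp
next
  case (insert i I)
  then show ?case using form_mult[of t "f i" "card I * t" "\<lambda>x. \<Prod>i\<in>I. f i x"] by simp
qed

lemma form_power: "form t f \<Longrightarrow> form (n * t) (\<lambda>x. f x ^ n)"
  using form_prod[of "{..<n}" t "\<lambda>_. f"] by simp

lemma form_nth: "form 1 (\<lambda>x. x $ i)"
proof -
  let ?\<alpha> = "\<lambda>j. if j = i then 1 else 0"
  have m: "mon ?\<alpha> = (\<lambda>x. x $ i)"
    unfolding mon_def by (auto simp: prod.delta if_distrib[of "\<lambda>k. _ ^ k"] cong: if_cong)
  have "?\<alpha> \<in> exps 1" by (simp add: exps_def sum.delta)
  from form_mon[OF this] show ?thesis unfolding m .
qed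

lemma form_linear: "form 1 (\<lambda>x. \<Sum>i\<in>UNIV. c i * x $ i)"
  by (intro form_sum form_scale form_nth)

lemma cpoly_form: "form t f \<Longrightarrow> pcurve \<gamma> \<Longrightarrow> cpoly (\<lambda>s. f (\<gamma> s))"
  unfolding form_iff mon_def by (auto intro!: poly_intros)

lemma form_homogeneous:
  assumes "form t f" shows "f (c *s x) = c ^ t * f x"
proof -
  obtain a where f: "f = (\<lambda>x. \<Sum>\<alpha>\<in>exps t. a \<alpha> * mon \<alpha> x)" using assms unfolding form_iff by blast
  have "mon \<alpha> (c *s x) = c ^ t * mon \<alpha> x" if "\<alpha> \<in> exps t" for \<alpha>
    using that by (simp add: mon_def power_mult_distrib prod.distrib exps_def power_sum[symmetric])
  then show ?thesis by (simp add: f sum_distrib_left mult_ac)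
qed

lemma form_1_linear:
  assumes "form 1 f"
  shows "f (x + y) = f x + f y" "f (c *s x) = c * f x" "f (x - y) = f x - f y" "f 0 = 0"
proof -
  have *: "\<exists>i. mon \<alpha> = (\<lambda>x. x $ i)" if a: "\<alpha> \<in> exps 1" for \<alpha> :: "'a \<Rightarrow> nat"
  proof -
    from a have s: "sum \<alpha> UNIV = 1" by (simp add: exps_def)
    then obtain i where i: "\<alpha> i = 1" "\<forall>j\<in>UNIV. i \<noteq> j \<longrightarrow> \<alpha> j = 0"
      using sum_eq_1_iff[of UNIV \<alpha>] by auto
    then have "mon \<alpha> = (\<lambda>x. \<Prod>j\<in>UNIV. if j = i then x $ i else 1)"
      unfolding mon_def by (intro ext prod.cong) auto
    then show ?thesis by (auto simp: prod.delta)
  qed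
  obtain a where f: "f = (\<lambda>x. \<Sum>\<alpha>\<in>exps 1. a \<alpha> * mon \<alpha> x)" using assms unfolding form_iff by blast
  have add: "mon \<alpha> (x + y) = mon \<alpha> x + mon \<alpha> y" if "\<alpha> \<in> exps 1" for \<alpha> and x y :: "complex^'a"
    using *[OF that] by auto
  show 1: "f (x + y) = f x + f y" for x y
    unfolding f sum.distrib[symmetric] by (intro sum.cong) (auto simp: add algebra_simps)
  show 2: "f (c *s x) = c * f x" for c x using form_homogeneous[OF assms] by simp
  show "f (x - y) = f x - f y" using 1[of "x - y" y] by simp
  show "f 0 = 0" using 2[of 0 0] by simp
qed

section \<open>Interpolation\<close>

text \<open>The points \<open>v i\<close> impose independent conditions on forms of degree
  \<open>t\<close>. A family instead of a set lets points move with a parameter; two indices with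
  the same point count as dependent.\<close>

definition interp :: "nat \<Rightarrow> 'i set \<Rightarrow> ('i \<Rightarrow> complex^'n) \<Rightarrow> bool" where
  "interp t I v \<longleftrightarrow> (\<forall>g. \<exists>f. form t f \<and> (\<forall>i\<in>I. f (v i) = g i))"

lemma interpE:
  assumes "interp t I v"
  obtains f where "form t f" "\<And>i. i \<in> I \<Longrightarrow> f (v i) = g i"
  using assms unfolding interp_def by (elim allE[of _ g]) blast

lemma interp_mono: "interp t I v \<Longrightarrow> J \<subseteq> I \<Longrightarrow> interp t J v"
  unfolding interp_def by blast

lemma interp_cong: "(\<And>i. i \<in> I \<Longrightarrow> v i = w i) \<Longrightarrow> interp t I v \<longleftrightarrow> interp t I w"
  unfolding interp_def by simp

lemma interp_reindex:
  assumes "interp t I v" "h ` J \<subseteq> I" "inj_on h J" "\<And>j. j \<in> J \<Longrightarrow> w j = v (h j)"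
  shows "interp t J w"
  unfolding interp_def
proof
  fix g
  obtain f where "form t f" "\<And>i. i \<in> I \<Longrightarrow> f (v i) = g (inv_into J h i)"
    using interpE[OF assms(1), of "\<lambda>i. g (inv_into J h i)"] by blast
  then show "\<exists>f. form t f \<and> (\<forall>j\<in>J. f (w j) = g j)"
    using assms by (intro exI[of _ f]) (auto simp: image_subset_iff)
qed

lemma interp_inj:
  assumes "interp t I v" shows "inj_on v I"
proof (rule inj_onI, rule ccontr)
  fix i j assume ij: "i \<in> I" "j \<in> I" "v i = v j" "i \<noteq> j"
  obtain f where "form t f" "\<And>k. k \<in> I \<Longrightarrow> f (v k) = (if k = i then 1 else 0)"
    using interpE[OF assms, of "\<lambda>k. if k = i then 1 else 0"] by blast
  then show False using ij by (metis zero_neq_one)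
qed

lemma interp_image:
  assumes "interp t I v" shows "interp t (v ` I) (\<lambda>z. z)"
  by (rule interp_reindex[OF assms, of "inv_into I v"])
     (auto simp: inv_into_into f_inv_into_f intro: inj_on_inv_into)

lemma interp_dual:
  assumes "interp t I v" "i \<in> I"
  obtains f where "form t f" "f (v i) = 1" "\<And>j. j \<in> I \<Longrightarrow> j \<noteq> i \<Longrightarrow> f (v j) = 0"
proof -
  obtain f where f: "form t f" "\<And>k. k \<in> I \<Longrightarrow> f (v k) = (if k = i then 1 else 0)"
    using interpE[OF assms(1), of "\<lambda>k. if k = i then 1 else 0"] by blast
  show ?thesis by (rule that[OF f(1)]) (use f(2) assms(2) in auto)
qed

lemma interp_dual_family:
  assumes "interp t I v"
  shows "\<exists>F. \<forall>i\<in>I. form t (F i) \<and> (\<forall>j\<in>I. F i (v j) = (if i = j then 1 else 0))"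
proof (rule bchoice, rule ballI)
  fix i assume "i \<in> I"
  obtain f where f: "form t f" "\<And>j. j \<in> I \<Longrightarrow> f (v j) = (if i = j then 1 else 0)"
    using interpE[OF assms, of "\<lambda>j. if i = j then 1 else 0"] by blast
  then show "\<exists>f. form t f \<and> (\<forall>j\<in>I. f (v j) = (if i = j then 1 else 0))"
    by (intro exI[of _ f] conjI ballI)
qed

lemma interpI_dual:
  assumes "finite I"
    and ex: "\<And>i. i \<in> I \<Longrightarrow> \<exists>f. form t f \<and> f (v i) \<noteq> 0 \<and> (\<forall>j\<in>I. j \<noteq> i \<longrightarrow> f (v j) = 0)"
  shows "interp t I v"
  unfolding interp_def
proof
  fix g
  have "\<forall>i\<in>I. \<exists>f. form t f \<and> f (v i) \<noteq> 0 \<and> (\<forall>j\<in>I. j \<noteq> i \<longrightarrow> f (v j) = 0)"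
    using ex by blast
  then obtain F where F: "\<forall>i\<in>I. form t (F i) \<and> F i (v i) \<noteq> 0 \<and> (\<forall>j\<in>I. j \<noteq> i \<longrightarrow> F i (v j) = 0)"
    by (rule bchoice[THEN exE])
  let ?f = "\<lambda>x. \<Sum>i\<in>I. (g i / F i (v i)) * F i x"
  have "?f (v j) = g j" if j: "j \<in> I" for j
  proof -
    have "?f (v j) = (\<Sum>i\<in>I. if i = j then g j else 0)"
      using F j by (intro sum.cong) auto
    then show ?thesis using assms(1) j by simp
  qed
  moreover have "form t ?f" using F by (intro form_sum form_scale) auto
  ultimately show "\<exists>f. form t f \<and> (\<forall>j\<in>I. f (v j) = g j)" by (intro exI[of _ ?f]) auto
qed

lemma interp_insert:
  assumes "interp t I v" "i \<notin> I" "form t f" "\<And>j. j \<in> I \<Longrightarrow> f (v j) = 0" "f (v i) \<noteq> 0"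
  shows "interp t (insert i I) v"
  unfolding interp_def
proof
  fix g
  obtain h where h: "form t h" "\<And>i. i \<in> I \<Longrightarrow> h (v i) = g i"
    using interpE[OF assms(1), of g] by blast
  let ?h = "\<lambda>x. h x + ((g i - h (v i)) / f (v i)) * f x"
  have "form t ?h" by (intro form_add form_scale h assms)
  moreover have "\<forall>j\<in>insert i I. ?h (v j) = g j" using h(2) assms by auto
  ultimately show "\<exists>f. form t f \<and> (\<forall>j\<in>insert i I. f (v j) = g j)" by blast
qed

text \<open>By \<open>ne\<close>, the 2 by 2 determinant of \<open>f\<close>, \<open>g\<close> at
  the two new points is nonzero. Whichever form is nonzero at \<open>v i\<close> adds that point,
  and the combination cancelling there adds \<open>v j\<close>.\<close>

lemma interp_insert2:
  assumes "interp t I v" "i \<notin> I" "j \<notin> I" "i \<noteq> j"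
    and f: "form t f" "\<And>k. k \<in> I \<Longrightarrow> f (v k) = 0"
    and g: "form t g" "\<And>k. k \<in> I \<Longrightarrow> g (v k) = 0"
    and ne: "f (v i) * g (v j) \<noteq> f (v j) * g (v i)"
  shows "interp t (insert j (insert i I)) v"
proof -
  have *: "interp t (insert j (insert i I)) v"
    if F: "form t F" "\<forall>k\<in>I. F (v k) = 0" and G: "form t G" "\<forall>k\<in>I. G (v k) = 0"
    and ne: "F (v i) * G (v j) - F (v j) * G (v i) \<noteq> 0" "F (v i) \<noteq> 0" for F G
  proof (rule interp_insert)
    show "interp t (insert i I) v" using interp_insert[OF assms(1,2) F(1)] F(2) ne(2) by blast
    show "j \<notin> insert i I" using assms(3,4) by simp
    show "form t (\<lambda>x. F (v i) * G x - G (v i) * F x)" by (intro form_diff form_scale F G)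
    show "F (v i) * G (v k) - G (v i) * F (v k) = 0" if "k \<in> insert i I" for k
      using that F(2) G(2) by auto
    show "F (v i) * G (v j) - G (v i) * F (v j) \<noteq> 0" using ne by (simp add: mult.commute)
  qed
  have f0: "\<forall>k\<in>I. f (v k) = 0" and g0: "\<forall>k\<in>I. g (v k) = 0" using f(2) g(2) by blast+
  show ?thesis
  proof (cases "f (v i) = 0")
    case True
    then have "g (v i) * f (v j) - g (v j) * f (v i) \<noteq> 0" "g (v i) \<noteq> 0" using ne by auto
    then show ?thesis by (rule *[OF g(1) g0 f(1) f0])
  next
    case False
    have "f (v i) * g (v j) - f (v j) * g (v i) \<noteq> 0" using ne by simp
    then show ?thesis using False by (rule *[OF f(1) f0 g(1) g0])
  qed
qed

text \<open>The forms \<open>F i s\<close> and the denominator \<open>\<Delta> s\<close> play the role of the adjugate and the determinant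
  of the interpolation matrix.\<close>
lemma interp_adjugate:
  fixes v :: "'i \<Rightarrow> complex \<Rightarrow> complex^'n"
  assumes "finite I" "\<And>i. i \<in> I \<Longrightarrow> pcurve (v i)" "interp t I (\<lambda>i. v i s0)"
  shows "\<exists>F \<Delta>. cpoly \<Delta> \<and> \<Delta> s0 \<noteq> 0 \<and>
    (\<forall>i\<in>I. (\<forall>s. form t (F i s)) \<and> (\<forall>\<gamma>. pcurve \<gamma> \<longrightarrow> cpoly (\<lambda>s. F i s (\<gamma> s))) \<and>
       (\<forall>s. \<forall>j\<in>I. F i s (v j s) = (if i = j then \<Delta> s else 0)))"
  using assms
proof (induction I rule: finite_induct)
  case empty
  show ?case by (intro exI[of _ "\<lambda>_. 1"] exI) (auto intro: poly_intros)
next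
  case (insert k I)
  have "interp t I (\<lambda>i. v i s0)" using insert.prems interp_mono by blast
  then obtain F \<Delta> where \<Delta>: "cpoly \<Delta>" "\<Delta> s0 \<noteq> 0"
    and *: "\<forall>i\<in>I. (\<forall>s. form t (F i s)) \<and> (\<forall>\<gamma>. pcurve \<gamma> \<longrightarrow> cpoly (\<lambda>s. F i s (\<gamma> s))) \<and>
       (\<forall>s. \<forall>j\<in>I. F i s (v j s) = (if i = j then \<Delta> s else 0))"
    using insert.IH[OF insert.prems(1)] by blast
  have F: "\<And>i s. i \<in> I \<Longrightarrow> form t (F i s)"
      "\<And>i \<gamma>. i \<in> I \<Longrightarrow> pcurve \<gamma> \<Longrightarrow> cpoly (\<lambda>s. F i s (\<gamma> s))"
      "\<And>i j s. i \<in> I \<Longrightarrow> j \<in> I \<Longrightarrow> F i s (v j s) = (if i = j then \<Delta> s else 0)"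
    using * by blast+
  obtain f where f: "form t f" "f (v k s0) = 1" "\<And>j. j \<in> insert k I \<Longrightarrow> j \<noteq> k \<Longrightarrow> f (v j s0) = 0"
    by (rule interp_dual[OF insert.prems(2), of k]) auto
  have f0: "f (v j s0) = 0" if "j \<in> I" for j using f(3)[of j] that insert.hyps(2) by blast
  \<comment> \<open>Up to the factor \<open>\<Delta> s\<close>, this is \<open>f\<close> minus its
    interpolant: it vanishes at the points of \<open>I\<close> for every \<open>s\<close>, and at
    \<open>s0\<close> it still has the value \<open>\<Delta> s0\<close> at the new point.\<close>
  define G where "G s x = \<Delta> s * f x - (\<Sum>i\<in>I. f (v i s) * F i s x)" for s x
  have Gform: "form t (G s)" for s unfolding G_def
    by (intro form_diff form_scale form_sum f F)
  have Gpoly: "cpoly (\<lambda>s. G s (\<gamma> s))" if "pcurve \<gamma>" for \<gamma>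
    unfolding G_def using insert.prems(1)
    by (intro poly_intros \<Delta>(1) cpoly_form[OF f(1)] F(2) that) auto
  have G0: "G s (v j s) = 0" if "j \<in> I" for s j
  proof -
    have "(\<Sum>i\<in>I. f (v i s) * F i s (v j s)) = (\<Sum>i\<in>I. if i = j then f (v j s) * \<Delta> s else 0)"
      using F(3) that by (intro sum.cong) auto
    then show ?thesis using insert.hyps(1) that by (simp add: G_def)
  qed
  have Gs0: "G s0 (v k s0) \<noteq> 0" unfolding G_def using f(2) f0 \<Delta>(2) by simp
  define \<delta> where "\<delta> s = G s (v k s)" for s
  have \<delta>: "cpoly \<delta>" unfolding \<delta>_def using Gpoly insert.prems(1) by auto
  define F' where "F' i s x = (if i = k then \<Delta> s * G s x else \<delta> s * F i s x - F i s (v k s) * G s x)" for i s x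
  show ?case
  proof (intro exI[of _ F'] exI[of _ "\<lambda>s. \<Delta> s * \<delta> s"] conjI ballI allI impI)
    show "cpoly (\<lambda>s. \<Delta> s * \<delta> s)" by (intro poly_intros \<Delta> \<delta>)
    show "\<Delta> s0 * \<delta> s0 \<noteq> 0" using \<Delta> Gs0 \<delta>_def by simp
    fix i assume i: "i \<in> insert k I"
    show "form t (F' i s)" for s
      unfolding F'_def using i F(1)[of i s]
      by (cases "i = k") (auto intro!: form_diff form_scale Gform)
    show "cpoly (\<lambda>s. F' i s (\<gamma> s))" if "pcurve \<gamma>" for \<gamma>
      unfolding F'_def using i F(2)[of i \<gamma>] F(2)[of i "v k"] that insert.prems(1)
      by (cases "i = k") (auto intro!: poly_intros Gpoly \<Delta> \<delta>)
    show "F' i s (v j s) = (if i = j then \<Delta> s * \<delta> s else 0)" if j: "j \<in> insert k I" for s j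
      using i j G0[of j s] G0[of i s] F(3)[of i j s] insert.hyps(2)
      by (cases "i = k"; cases "j = k") (auto simp: F'_def \<delta>_def)
  qed
qed

lemma interp_cofinite:
  fixes v :: "'i \<Rightarrow> complex \<Rightarrow> complex^'n"
  assumes "finite I" "\<And>i. i \<in> I \<Longrightarrow> pcurve (v i)" "interp t I (\<lambda>i. v i s0)"
  shows "finite {s. \<not> interp t I (\<lambda>i. v i s)}"
proof -
  obtain F \<Delta> where \<Delta>: "cpoly \<Delta>" "\<Delta> s0 \<noteq> 0"
    and F: "\<forall>i\<in>I. (\<forall>s. form t (F i s)) \<and> (\<forall>\<gamma>. pcurve \<gamma> \<longrightarrow> cpoly (\<lambda>s. F i s (\<gamma> s))) \<and>
       (\<forall>s. \<forall>j\<in>I. F i s (v j s) = (if i = j then \<Delta> s else 0))"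
    using interp_adjugate[OF assms] by blast
  have "interp t I (\<lambda>i. v i s)" if "\<Delta> s \<noteq> 0" for s
  proof (rule interpI_dual[OF assms(1)])
    fix i assume "i \<in> I"
    then show "\<exists>f. form t f \<and> f (v i s) \<noteq> 0 \<and> (\<forall>j\<in>I. j \<noteq> i \<longrightarrow> f (v j s) = 0)"
      using F that by (intro exI[of _ "F i s"]) auto
  qed
  then have "{s. \<not> interp t I (\<lambda>i. v i s)} \<subseteq> {s. \<Delta> s = 0}" by auto
  then show ?thesis using cpoly_finite_zeros[OF \<Delta>] finite_subset by blast
qed

text \<open>Multiply the dual form of each point by a coordinate that does not vanish there.\<close>

lemma interp_Suc:
  assumes "finite I" "interp t I v" "\<And>i. i \<in> I \<Longrightarrow> v i \<noteq> 0"
  shows "interp (Suc t) I v"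
proof (rule interpI_dual[OF assms(1)])
  fix i assume i: "i \<in> I"
  obtain k where k: "v i $ k \<noteq> 0" using assms(3)[OF i] by (auto simp: vec_eq_iff)
  obtain f where f: "form t f" "f (v i) = 1" "\<And>j. j \<in> I \<Longrightarrow> j \<noteq> i \<Longrightarrow> f (v j) = 0"
    using interp_dual[OF assms(2) i] by blast
  have "form (Suc t) (\<lambda>x. x $ k * f x)" using form_mult[OF form_nth f(1)] by simp
  then show "\<exists>f. form (Suc t) f \<and> f (v i) \<noteq> 0 \<and> (\<forall>j\<in>I. j \<noteq> i \<longrightarrow> f (v j) = 0)"
    using k f by (intro exI[of _ "\<lambda>x. x $ k * f x"]) auto
qed

text \<open>The dual form of a point is the product of the \<open>card I - 1\<close> forms
  separating it from each other point. The degree is crude, but it leaves only finitely many degrees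
  to treat.\<close>

lemma interp_pairs:
  assumes "finite I" "\<And>i j. i \<in> I \<Longrightarrow> j \<in> I \<Longrightarrow> i \<noteq> j \<Longrightarrow> interp t {i, j} v"
  shows "interp ((card I - 1) * t) I v"
proof (rule interpI_dual[OF assms(1)])
  fix i assume i: "i \<in> I"
  have "\<forall>j\<in>I - {i}. \<exists>f. form t f \<and> f (v i) = 1 \<and> f (v j) = 0"
  proof
    fix j assume j: "j \<in> I - {i}"
    then have "interp t {i, j} v" using assms(2) i by blast
    then obtain f where "form t f" "f (v i) = 1" "\<And>k. k \<in> {i, j} \<Longrightarrow> k \<noteq> i \<Longrightarrow> f (v k) = 0"
      by (rule interp_dual[of _ _ _ i]) auto
    then show "\<exists>f. form t f \<and> f (v i) = 1 \<and> f (v j) = 0" using j by (intro exI[of _ f]) auto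
  qed
  then obtain F where F: "\<forall>j\<in>I - {i}. form t (F j) \<and> F j (v i) = 1 \<and> F j (v j) = 0"
    by (rule bchoice[THEN exE])
  have c: "card (I - {i}) = card I - 1" using i assms(1) by simp
  let ?f = "\<lambda>x. \<Prod>j\<in>I - {i}. F j x"
  have "form (card (I - {i}) * t) ?f" using F assms(1) by (intro form_prod) auto
  moreover have "?f (v i) = 1" using F by (auto intro!: prod.neutral)
  moreover have "?f (v j) = 0" if "j \<in> I" "j \<noteq> i" for j
    using F that assms(1) by (intro prod_zero) auto
  ultimately show "\<exists>f. form ((card I - 1) * t) f \<and> f (v i) \<noteq> 0 \<and> (\<forall>j\<in>I. j \<noteq> i \<longrightarrow> f (v j) = 0)"
    unfolding c by (intro exI[of _ ?f]) simp
qed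

section \<open>Counting conditions against independent points\<close>

lemma homogeneous_system_nontrivial:
  fixes a :: "'a \<Rightarrow> 'b \<Rightarrow> complex"
  assumes "finite Z" "finite Y" "card Z < card Y"
  shows "\<exists>c. (\<exists>y\<in>Y. c y \<noteq> 0) \<and> (\<forall>z\<in>Z. (\<Sum>y\<in>Y. c y * a y z) = 0)"
  using assms
proof (induction Z arbitrary: Y a rule: finite_induct)
  case empty
  then obtain y where "y \<in> Y" by fastforce
  then show ?case by (intro exI[of _ "\<lambda>_. 1"]) auto
next
  case (insert z Z)
  show ?case
  proof (cases "\<forall>y\<in>Y. a y z = 0")
    case True
    then show ?thesis using insert.IH[of Y a] insert by auto
  next
    case False
    then obtain p where p: "p \<in> Y" "a p z \<noteq> 0" by auto
    have "card Z < card (Y - {p})" using insert p by simp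
    with insert.IH[of "Y - {p}" "\<lambda>y w. a y w - a y z / a p z * a p w"] insert.prems(1)
    obtain c where c: "\<exists>y\<in>Y - {p}. c y \<noteq> 0"
      "\<And>w. w \<in> Z \<Longrightarrow> (\<Sum>y\<in>Y - {p}. c y * (a y w - a y z / a p z * a p w)) = 0" by auto
    define C where "C = - (\<Sum>y\<in>Y - {p}. c y * a y z) / a p z"
    define c' where "c' y = (if y = p then C else c y)" for y
    have s: "(\<Sum>y\<in>Y. c' y * a y w) = C * a p w + (\<Sum>y\<in>Y - {p}. c y * a y w)" for w
      using sum.remove[OF insert.prems(1) p(1), of "\<lambda>y. c' y * a y w"]
      by (simp add: c'_def)
    have "(\<Sum>y\<in>Y. c' y * a y w) = 0" if "w \<in> insert z Z" for w
    proof (cases "w = z")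
      case True
      then show ?thesis using s[of z] p by (simp add: C_def)
    next
      case False
      then have "(\<Sum>y\<in>Y - {p}. c y * a y w) - (\<Sum>y\<in>Y - {p}. c y * a y z) / a p z * a p w = 0"
        using c(2)[of w] that by (simp add: algebra_simps sum_subtractf sum_distrib_left sum_distrib_right sum_divide_distrib)
      then show ?thesis unfolding s C_def by (simp add: algebra_simps)
    qed
    moreover have "\<exists>y\<in>Y. c' y \<noteq> 0" using c(1) by (auto simp: c'_def)
    ultimately show ?thesis by (intro exI[of _ c']) auto
  qed
qed

text \<open>Among the combinations of the \<open>card Y\<close> dual forms of \<open>Y\<close>,
  fewer than \<open>card Y\<close> zeros leave a nontrivial one, and its value at \<open>w y\<close>
  is its coefficient at \<open>y\<close>. With \<open>Y\<close> on the quadric, this produces forms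
  that vanish at given points but not on the quadric.\<close>

lemma interp_exchange:
  assumes "finite I" "finite Y" "card I < card Y" "interp t Y w"
  shows "\<exists>f y. form t f \<and> (\<forall>i\<in>I. f (v i) = 0) \<and> y \<in> Y \<and> f (w y) \<noteq> 0"
proof -
  obtain F where F: "\<forall>y\<in>Y. form t (F y) \<and> (\<forall>j\<in>Y. F y (w j) = (if y = j then 1 else 0))"
    using interp_dual_family[OF assms(4)] by blast
  obtain c where c: "\<exists>y\<in>Y. c y \<noteq> 0" "\<forall>i\<in>I. (\<Sum>y\<in>Y. c y * F y (v i)) = 0"
    using homogeneous_system_nontrivial[OF assms(1-3), of "\<lambda>y i. F y (v i)"] by blast
  obtain y0 where y0: "y0 \<in> Y" "c y0 \<noteq> 0" using c(1) by blast
  let ?f = "\<lambda>x. \<Sum>y\<in>Y. c y * F y x"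
  have "?f (w y0) = (\<Sum>y\<in>Y. if y = y0 then c y0 else 0)"
    using F y0(1) by (intro sum.cong) auto
  then have "?f (w y0) \<noteq> 0" using assms(2) y0 by simp
  moreover have "form t ?f" using F by (intro form_sum form_scale) simp
  ultimately show ?thesis using c(2) y0(1) by (intro exI[of _ ?f] exI[of _ y0] conjI)
qed

lemma form_1_expand:
  assumes "form 1 f" shows "f x = (\<Sum>j\<in>UNIV. f (axis j 1) * x $ j)"
proof -
  have *: "f (\<Sum>j\<in>J. x $ j *s axis j 1) = (\<Sum>j\<in>J. f (axis j 1) * x $ j)" for J
    by (induction J rule: infinite_finite_induct)
       (auto simp: form_1_linear[OF assms] mult.commute)
  show ?thesis using *[of UNIV] by (simp only: basis_expansion)
qed

lemma interp_axis: "interp 1 UNIV (\<lambda>j::'n::finite. axis j 1)"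
proof (rule interpI_dual)
  fix i :: 'n
  show "\<exists>f. form 1 f \<and> f (axis i 1) \<noteq> 0 \<and> (\<forall>j\<in>UNIV. j \<noteq> i \<longrightarrow> f (axis j 1) = 0)"
    using form_nth[of i] by (intro exI[of _ "\<lambda>x. x $ i"]) (auto simp: axis_def)
qed simp

text \<open>Otherwise \<open>y\<close> and the \<open>v i\<close> would be more than
  \<open>CARD('n)\<close> independent points for linear forms, and exchange against the axis vectors
  would give a nonzero linear form killing all axis vectors.\<close>

lemma interp_1_eq_0:
  fixes v :: "'i \<Rightarrow> complex^'n"
  assumes "finite I" "interp 1 I v" "card I = CARD('n)" "form 1 f" "\<And>i. i \<in> I \<Longrightarrow> f (v i) = 0"
  shows "f y = 0"
proof (rule ccontr)
  assume fy: "f y \<noteq> 0"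
  let ?w = "\<lambda>i. case i of None \<Rightarrow> y | Some i \<Rightarrow> v i"
  have 1: "interp 1 (Some ` I) ?w"
    by (rule interp_reindex[OF assms(2), of the]) (auto intro: inj_onI)
  have "interp 1 (insert None (Some ` I)) ?w"
    by (rule interp_insert[OF 1 _ assms(4)]) (use assms(5) fy in auto)
  moreover have "card (UNIV :: 'n set) < card (insert None (Some ` I))"
    using assms(1,3) by (simp add: card_image)
  ultimately obtain h i where h: "form 1 h" "\<forall>j::'n\<in>UNIV. h (axis j 1) = 0" "h (?w i) \<noteq> 0"
    using interp_exchange[of "UNIV :: 'n set" "insert None (Some ` I)" 1 ?w "\<lambda>j. axis j 1"] assms(1)
    by (elim exE conjE meta_impE) auto
  have "h x = 0" for x using form_1_expand[OF h(1), of x] h(2) by simp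
  then show False using h(3) by blast
qed

lemma interp_1_expand:
  fixes v :: "'i \<Rightarrow> complex^'n"
  assumes "finite I" "interp 1 I v" "card I = CARD('n)"
  shows "\<exists>c. y = (\<Sum>i\<in>I. c i *s v i)"
proof -
  obtain F where F: "\<forall>i\<in>I. form 1 (F i) \<and> (\<forall>j\<in>I. F i (v j) = (if i = j then 1 else 0))"
    using interp_dual_family[OF assms(2)] by blast
  have "y $ k = (\<Sum>i\<in>I. F i y *s v i) $ k" for k
  proof -
    let ?h = "\<lambda>x. x $ k - (\<Sum>i\<in>I. v i $ k * F i x)"
    have "?h (v j) = 0" if "j \<in> I" for j
    proof -
      have "(\<Sum>i\<in>I. v i $ k * F i (v j)) = (\<Sum>i\<in>I. if i = j then v j $ k else 0)"
        using F that by (intro sum.cong) auto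
      then show ?thesis using that assms(1) by simp
    qed
    moreover have "form 1 ?h" using F by (intro form_diff form_nth form_sum form_scale) simp
    ultimately have "?h y = 0" using interp_1_eq_0[OF assms, of ?h] by blast
    then show ?thesis by (simp add: mult.commute)
  qed
  then show ?thesis by (metis vec_eq_iff)
qed

lemma complex_quadratic_root:
  assumes "a \<noteq> 0" shows "\<exists>s::complex. a * s\<^sup>2 + b * s + c = 0"
proof -
  define d where "d = csqrt (b\<^sup>2 - 4 * a * c)"
  have d: "d\<^sup>2 = b\<^sup>2 - 4 * a * c" by (simp add: d_def)
  have "a * ((- b + d) / (2 * a))\<^sup>2 + b * ((- b + d) / (2 * a)) + c = (d\<^sup>2 - (b\<^sup>2 - 4 * a * c)) / (4 * a)"
    using assms by (simp add: field_simps power2_eq_square)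
  then show ?thesis unfolding d by (intro exI[of _ "(- b + d) / (2 * a)"]) simp
qed

section \<open>The quadric and its reflections\<close>

locale symmetric_form =
  fixes A :: "complex^'n^'n"
  assumes symA: "transpose A = A"
begin

abbreviation "b \<equiv> bform A"
abbreviation "q \<equiv> qform A"

lemma b_sym: "b x y = b y x"
proof -
  have "transpose A $ i $ j = A $ j $ i" for i j by (simp add: transpose_def)
  then have "A $ i $ j = A $ j $ i" for i j unfolding symA .
  then have "b x y = (\<Sum>i\<in>UNIV. \<Sum>j\<in>UNIV. A $ j $ i * y $ j * x $ i)"
    unfolding bform_def by (simp add: mult_ac)
  also have "\<dots> = b y x" unfolding bform_def by (rule sum.swap)
  finally show ?thesis .
qed

lemma q_b: "q x = b x x"
  by (simp add: qform_def bform_def)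

lemma b_right: "b x (y + z) = b x y + b x z" "b x (y - z) = b x y - b x z"
    "b x (c *s y) = c * b x y" "b x 0 = 0" "b x (- y) = - b x y"
  by (simp_all add: bform_def algebra_simps sum.distrib sum_subtractf sum_distrib_left sum_negf)

lemma b_left: "b (y + z) x = b y x + b z x" "b (y - z) x = b y x - b z x"
    "b (c *s y) x = c * b y x" "b 0 x = 0" "b (- y) x = - b y x"
  by (simp_all add: bform_def algebra_simps sum.distrib sum_subtractf sum_distrib_left sum_negf)

lemmas b_simps = b_left b_right

lemma q_simps: "q (c *s x) = c\<^sup>2 * q x" "q (x + y) = q x + 2 * b x y + q y"
    "q (x - y) = q x - 2 * b x y + q y" "q 0 = 0"
  by (simp_all add: q_b b_simps b_sym[of y x] power2_eq_square)

lemma cpoly_b [poly_intros]: "pcurve u \<Longrightarrow> pcurve v \<Longrightarrow> cpoly (\<lambda>s. b (u s) (v s))"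
  unfolding bform_def by (auto intro!: poly_intros)

lemma cpoly_q [poly_intros]: "pcurve u \<Longrightarrow> cpoly (\<lambda>s. q (u s))"
  unfolding q_b by (auto intro!: poly_intros)

lemma form_b: "form 1 (b x)"
proof -
  have "b x = (\<lambda>y. \<Sum>j\<in>UNIV. (\<Sum>i\<in>UNIV. A $ i $ j * x $ i) * y $ j)"
    unfolding bform_def fun_eq_iff by (subst sum.swap) (simp add: sum_distrib_right)
  then show ?thesis using form_linear by simp
qed

text \<open>The reflection of \<open>p\<close> along \<open>u\<close>, multiplied by \<open>q u\<close> to make it polynomial in both arguments.
  It maps a point \<open>p\<close> of the quadric to the second point of the quadric on the line through \<open>u\<close>
  and \<open>p\<close>.\<close>
definition refl :: "complex^'n \<Rightarrow> complex^'n \<Rightarrow> complex^'n" where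
  "refl u p = q u *s p - (2 * b u p) *s u"

lemma b_refl: "b (refl u x) (refl u y) = (q u)\<^sup>2 * b x y"
  by (simp add: refl_def b_simps b_sym[of x u] q_b algebra_simps power2_eq_square)

lemma b_refl_left: "b (refl u x) y = q u * b x y - 2 * b u x * b u y"
  by (simp add: refl_def b_simps)

lemma q_refl: "q (refl u x) = (q u)\<^sup>2 * q x"
  unfolding q_b[of "refl u x"] q_b[of x] b_refl ..

lemma refl_refl: "refl u (refl u x) = (q u)\<^sup>2 *s x"
  by (simp add: refl_def b_simps q_b vec_eq_iff algebra_simps power2_eq_square)

text \<open>The conjugation rule for reflections. The scaling of \<open>refl\<close> contributes the
  same factor \<open>(q u)\<^sup>2 * q v\<close> on both sides.\<close>

lemma refl_conj: "refl u (refl v (refl u x)) = refl (refl u v) x"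
proof -
  have *: "b (refl u v) x = q u * b v x - 2 * b u v * b u x"
    by (simp add: refl_def b_simps)
  have "refl (refl u v) x = ((q u)\<^sup>2 * q v) *s x - (2 * b (refl u v) x) *s refl u v"
    by (simp add: refl_def[of "refl u v"] q_refl)
  then show ?thesis unfolding *
    by (simp add: refl_def b_simps b_sym[of v u] q_b vec_eq_iff) (simp add: algebra_simps power2_eq_square)
qed

lemma refl_scale_left: "refl (c *s u) p = c\<^sup>2 *s refl u p"
  by (simp add: refl_def b_simps q_simps vec_eq_iff algebra_simps power2_eq_square)

lemma refl_scale_right: "refl u (c *s p) = c *s refl u p"
  by (simp add: refl_def b_simps vec_eq_iff algebra_simps)

lemma pcurve_refl [poly_intros]: "pcurve u \<Longrightarrow> pcurve v \<Longrightarrow> pcurve (\<lambda>s. refl (u s) (v s))"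
  unfolding refl_def by (intro poly_intros) auto

text \<open>A Gram-Schmidt step, \<open>\<pi>\<close> being the projection to the orthogonal
  complement of \<open>E\<close>. If all \<open>\<pi> x\<close> were isotropic, polarisation would
  put them into the kernel of \<open>A\<close>; then the image of \<open>A\<close> would be spanned
  by the \<open>A *v e\<close>, making the rank at most \<open>card E\<close>.\<close>

lemma ex_orthogonal_unit:
  assumes "finite E" "card E < rank A"
    and E: "\<And>e. e \<in> E \<Longrightarrow> b e e = 1" "\<And>e e'. e \<in> E \<Longrightarrow> e' \<in> E \<Longrightarrow> e \<noteq> e' \<Longrightarrow> b e e' = 0"
  shows "\<exists>u. b u u = 1 \<and> (\<forall>e\<in>E. b u e = 0)"
proof -
  define \<pi> where "\<pi> x = x - (\<Sum>e\<in>E. b x e *s e)" for x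
  have b_sum: "b (\<Sum>e\<in>E. c e *s e) y = (\<Sum>e\<in>E. c e * b e y)" for c y
    by (induction E rule: infinite_finite_induct) (simp_all add: b_simps)
  have \<pi>E: "b (\<pi> x) e = 0" if "e \<in> E" for x e
  proof -
    have "(\<Sum>e'\<in>E. b x e' * b e' e) = (\<Sum>e'\<in>E. if e' = e then b x e else 0)"
      using E that by (intro sum.cong) auto
    then show ?thesis using assms(1) that by (simp add: \<pi>_def b_simps b_sum)
  qed
  have \<pi>_add: "\<pi> (x + y) = \<pi> x + \<pi> y" for x y
    by (simp add: \<pi>_def b_simps sum.distrib vec.scale_left_distrib)
  have "\<exists>x. q (\<pi> x) \<noteq> 0"
  proof (rule ccontr)
    assume "\<not> ?thesis"
    then have q0: "q (\<pi> x) = 0" for x by blast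
    have b0: "b (\<pi> x) (\<pi> y) = 0" for x y
      using q_simps(2)[of "\<pi> x" "\<pi> y"] q0[of "x + y"] q0[of x] q0[of y] unfolding \<pi>_add by simp
    have "b (\<pi> x) y = 0" for x y
    proof -
      have "y = \<pi> y + (\<Sum>e\<in>E. b y e *s e)" by (simp add: \<pi>_def)
      then have "b (\<pi> x) y = b (\<pi> x) (\<pi> y) + b (\<Sum>e\<in>E. b y e *s e) (\<pi> x)"
        by (metis b_right(1) b_sym)
      also have "\<dots> = 0" unfolding b0 b_sum by (simp add: b_sym[of _ "\<pi> x"] \<pi>E)
      finally show ?thesis .
    qed
    moreover have "(A *v u) $ j = b u (axis j 1)" for u j
    proof -
      have "b u (axis j 1) = b (axis j 1) u" by (rule b_sym)
      also have "\<dots> = (\<Sum>i\<in>UNIV. if i = j then (A *v u) $ j else 0)"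
        unfolding bform_def matrix_vector_mult_def by (intro sum.cong) (auto simp: axis_def)
      finally show ?thesis by simp
    qed
    ultimately have "A *v \<pi> x = 0" for x by (simp add: vec_eq_iff)
    then have Ax: "A *v x = (\<Sum>e\<in>E. b x e *s (A *v e))" for x
    proof -
      have "A *v x = A *v \<pi> x + A *v (\<Sum>e\<in>E. b x e *s e)"
        by (simp add: \<pi>_def flip: matrix_vector_right_distrib)
      also have "A *v (\<Sum>e\<in>E. b x e *s e) = (\<Sum>e\<in>E. b x e *s (A *v e))"
        by (simp add: vec.sum vec.scale)
      finally show ?thesis using \<open>\<And>x. A *v \<pi> x = 0\<close> by simp
    qed
    have "rows A \<subseteq> vec.span ((*v) A ` E)"
    proof
      fix r assume "r \<in> rows A"
      then obtain i where "r = row i A" by (auto simp: rows_def)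
      also have "row i A = column i (transpose A)" by (simp add: row_def column_def transpose_def)
      also have "\<dots> = A *v axis i 1" unfolding symA
        by (simp add: vec_eq_iff column_def matrix_vector_mult_def axis_def if_distrib cong: if_cong)
      finally show "r \<in> vec.span ((*v) A ` E)" unfolding Ax[of "axis i 1"]
        by (simp, intro vec.span_sum vec.span_scale vec.span_base imageI)
    qed
    then have "rank A \<le> card ((*v) A ` E)"
      unfolding row_rank_def_gen using assms(1) by (intro vec.dim_le_card) auto
    also have "\<dots> \<le> card E" using assms(1) by (rule card_image_le)
    finally show False using assms(2) by simp
  qed
  then obtain x where x: "q (\<pi> x) \<noteq> 0" by blast
  let ?s = "csqrt (q (\<pi> x))"
  have "b ((1 / ?s) *s \<pi> x) ((1 / ?s) *s \<pi> x) = q (\<pi> x) / (?s)\<^sup>2"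
    by (simp add: b_simps q_b power2_eq_square)
  then have "b ((1 / ?s) *s \<pi> x) ((1 / ?s) *s \<pi> x) = 1" using x by simp
  then show ?thesis using \<pi>E by (intro exI[of _ "(1 / ?s) *s \<pi> x"]) (simp add: b_simps)
qed

lemma ex_orthonormal3:
  assumes "rank A \<ge> 3"
  shows "\<exists>e1 e2 e3. b e1 e1 = 1 \<and> b e2 e2 = 1 \<and> b e3 e3 = 1 \<and> b e1 e2 = 0 \<and> b e1 e3 = 0 \<and> b e2 e3 = 0"
proof -
  obtain e1 where e1: "b e1 e1 = 1" using ex_orthogonal_unit[of "{}"] assms by auto
  obtain e2 where e2: "b e2 e2 = 1" "b e2 e1 = 0" using ex_orthogonal_unit[of "{e1}"] assms e1 by auto
  have "card {e1, e2} < rank A" using assms card_insert_le_m1[of 2 "{e2}" e1] by simp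
  then obtain e3 where "b e3 e3 = 1" "b e3 e1 = 0" "b e3 e2 = 0"
    using ex_orthogonal_unit[of "{e1, e2}"] e1 e2 b_sym[of e1 e2] by auto
  then show ?thesis using e1 e2 b_sym by metis
qed

end

text \<open>Two of the orthonormal vectors yield isotropic \<open>w0\<close>, \<open>w1\<close> with
  nonzero pairing; all three yield a nonisotropic vector orthogonal to any given one.\<close>

locale quadric = symmetric_form A for A :: "complex^'n^'n" +
  fixes e1 e2 e3 :: "complex^'n"
  assumes orth: "bform A e1 e1 = 1" "bform A e2 e2 = 1" "bform A e3 e3 = 1"
      "bform A e1 e2 = 0" "bform A e1 e3 = 0" "bform A e2 e3 = 0"
begin

definition w0 where "w0 = e1 + \<i> *s e2"
definition w1 where "w1 = e1 - \<i> *s e2"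

lemma w_simps: "q w0 = 0" "q w1 = 0" "b w1 w0 = 2" "b w0 w1 = 2" "b e1 w0 = 1"
  using orth b_sym[of e2 e1] by (auto simp: w0_def w1_def q_simps q_b b_simps)

text \<open>Reflecting the fixed point \<open>w0\<close> parametrises the quadric by polynomials.\<close>
definition psi where "psi x = refl x w0"

lemma q_psi [simp]: "q (psi x) = 0"
  by (simp add: psi_def q_refl w_simps)

lemma pcurve_psi [poly_intros]: "pcurve u \<Longrightarrow> pcurve (\<lambda>s. psi (u s))"
  unfolding psi_def by (intro poly_intros)

text \<open>Reflection along \<open>y - w0\<close> sends \<open>w0\<close> to a multiple of
  \<open>y\<close>; since \<open>psi\<close> is quadratic, a square root \<open>c\<close> absorbs
  the factor.\<close>

lemma psi_surj:
  assumes "q y = 0" "b y w0 \<noteq> 0" shows "\<exists>x. psi x = y"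
proof -
  define c where "c = csqrt (- 1 / (2 * b y w0))"
  have c: "c\<^sup>2 = - 1 / (2 * b y w0)" unfolding c_def by simp
  have "refl (y - w0) w0 = (- 2 * b y w0) *s y"
    using assms w_simps by (simp add: refl_def q_simps b_simps q_b[symmetric] vec_eq_iff algebra_simps)
  then have "psi (c *s (y - w0)) = (c\<^sup>2 * (- 2 * b y w0)) *s y"
    unfolding psi_def refl_scale_left by (simp add: vec_eq_iff)
  also have "c\<^sup>2 * (- 2 * b y w0) = 1" unfolding c using assms(2) by simp
  finally show ?thesis by (metis vec.scale_one)
qed

text \<open>If the orthogonal complement of \<open>p\<close> were totally isotropic, testing it on
  combinations of two of the \<open>e\<close>'s would give \<open>b e1 p = 0\<close>, although
  \<open>q e1 = 1\<close>.\<close>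

lemma ex_nonisotropic_orthogonal: "\<exists>a. b a p = 0 \<and> q a \<noteq> 0"
proof (rule ccontr)
  assume "\<not> ?thesis"
  then have *: "\<And>a. b a p = 0 \<Longrightarrow> q a = 0" by blast
  have s: "b e2 e1 = 0" "b e3 e1 = 0" "b e3 e2 = 0" using orth b_sym by metis+
  let ?x = "b e1 p" and ?y = "b e2 p" and ?z = "b e3 p"
  have 1: "?x\<^sup>2 + ?y\<^sup>2 = 0"
    using *[of "?y *s e1 - ?x *s e2"] orth s by (simp add: b_simps q_b power2_eq_square add.commute)
  have 2: "?x\<^sup>2 + ?z\<^sup>2 = 0"
    using *[of "?z *s e1 - ?x *s e3"] orth s by (simp add: b_simps q_b power2_eq_square add.commute)
  have 3: "?y\<^sup>2 + ?z\<^sup>2 = 0"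
    using *[of "?z *s e2 - ?y *s e3"] orth s by (simp add: b_simps q_b power2_eq_square add.commute)
  have "2 * ?x\<^sup>2 = (?x\<^sup>2 + ?y\<^sup>2) + (?x\<^sup>2 + ?z\<^sup>2) - (?y\<^sup>2 + ?z\<^sup>2)" by (simp add: algebra_simps)
  then have "?x = 0" unfolding 1 2 3 by simp
  then show False using *[of e1] orth by (simp add: q_b)
qed

text \<open>Only points with \<open>b p w0 = 0\<close> can be missed by \<open>psi\<close>. Such a
  \<open>p\<close> is joined, by a polynomial curve inside the quadric, to points that are not
  missed.\<close>

lemma psi_dense:
  assumes "polyfun \<phi>" "q p = 0" "\<phi> p \<noteq> 0" shows "\<exists>x. \<phi> (psi x) \<noteq> 0"
proof -
  have *: ?thesis if \<gamma>: "pcurve \<gamma>" "\<And>s. q (\<gamma> s) = 0" "\<phi> (\<gamma> 0) \<noteq> 0" "b (\<gamma> s0) w0 \<noteq> 0" for \<gamma> s0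
  proof -
    obtain s where "\<phi> (\<gamma> s) \<noteq> 0" "b (\<gamma> s) w0 \<noteq> 0"
      using cpoly_common_nonzero[OF polyfun_comp[OF assms(1) \<gamma>(1)] \<gamma>(3) cpoly_b[OF \<gamma>(1) pcurve_const] \<gamma>(4)]
      by blast
    then show ?thesis using psi_surj[OF \<gamma>(2)[of s]] by metis
  qed
  show ?thesis
  proof (cases "b p w0 = 0")
    case False
    then show ?thesis using psi_surj[OF assms(2)] assms(3) by metis
  next
    case p0: True
    show ?thesis
    proof (cases "\<forall>u. b u p = 0")
      case True
      show ?thesis
      proof (rule *[of "\<lambda>s. p + s *s w1" 1])
        show "q (p + s *s w1) = 0" for s
          using True b_sym[of p w1] assms(2) w_simps by (simp add: q_simps b_simps)
      qed (use assms p0 w_simps in \<open>auto intro!: poly_intros simp: b_simps\<close>)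
    next
      case False
      then obtain u where u: "b u p \<noteq> 0" by blast
      have c: "pcurve (\<lambda>s. u + s *s (e1 - u))" by (intro poly_intros)
      have v: "b (u + 0 *s (e1 - u)) p \<noteq> 0" "b (u + 1 *s (e1 - u)) w0 \<noteq> 0" using u w_simps by simp_all
      have "\<exists>s. b (u + s *s (e1 - u)) p \<noteq> 0 \<and> b (u + s *s (e1 - u)) w0 \<noteq> 0"
        by (rule cpoly_common_nonzero[OF cpoly_b[OF c pcurve_const] v(1) cpoly_b[OF c pcurve_const] v(2)])
      then obtain v where v: "b v p \<noteq> 0" "b v w0 \<noteq> 0" by (elim exE conjE) (rule that)
      obtain a where a: "b a p = 0" "q a \<noteq> 0" using ex_nonisotropic_orthogonal by blast
      have c: "cpoly (\<lambda>s. b (a + s *s v) w0)" by (intro poly_intros)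
      have ne: "b (a + (if b a w0 = 0 then 1 else 0) *s v) w0 \<noteq> 0" using v by (simp add: b_simps)
      have "\<exists>s. s \<noteq> 0 \<and> b (a + s *s v) w0 \<noteq> 0"
        by (rule cpoly_common_nonzero[OF cpoly_id one_neq_zero c ne])
      then obtain s0 where s0: "s0 \<noteq> 0" "b (a + s0 *s v) w0 \<noteq> 0" by (elim exE conjE) (rule that)
      show ?thesis
      \<comment> \<open>Since \<open>b a p = 0\<close>, the curve passes through \<open>p\<close> at
        \<open>0\<close>. Since \<open>b p w0 = 0\<close>, its pairing with \<open>w0\<close> at
        \<open>s0\<close> is a nonzero multiple of
        \<open>b v p * b (a + s0 *s v) w0\<close>.\<close>
      proof (rule *[of "\<lambda>s. (1 / q a) *s refl (a + s *s v) p" s0])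
        show "pcurve (\<lambda>s. (1 / q a) *s refl (a + s *s v) p)" by (intro poly_intros)
        show "q ((1 / q a) *s refl (a + s *s v) p) = 0" for s by (simp add: q_simps q_refl assms(2))
        have "(1 / q a) *s refl (a + 0 *s v) p = p" using a by (simp add: refl_def)
        then show "\<phi> ((1 / q a) *s refl (a + 0 *s v) p) \<noteq> 0" using assms(3) by simp
        show "b ((1 / q a) *s refl (a + s0 *s v) p) w0 \<noteq> 0"
          using p0 s0 v a by (simp add: b_simps(3) b_refl_left) (simp add: b_simps)
      qed
    qed
  qed
qed

text \<open>Irreducibility of the quadric: a line in the parameter space of \<open>psi\<close> joins
  a witness for \<open>\<phi>\<close> to one for \<open>\<theta>\<close>.\<close>

lemma psi_dense2:
  assumes "polyfun \<phi>" "q p = 0" "\<phi> p \<noteq> 0" "polyfun \<theta>" "q r = 0" "\<theta> r \<noteq> 0"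
  shows "\<exists>x. \<phi> (psi x) \<noteq> 0 \<and> \<theta> (psi x) \<noteq> 0"
proof -
  obtain x y where xy: "\<phi> (psi x) \<noteq> 0" "\<theta> (psi y) \<noteq> 0" using psi_dense assms by meson
  have c: "pcurve (\<lambda>s. psi (x + s *s (y - x)))" by (intro poly_intros)
  show ?thesis
    using cpoly_common_nonzero[OF polyfun_comp[OF assms(1) c] _ polyfun_comp[OF assms(4) c], of 0 1] xy
    by auto
qed

lemma polyfun_form: "form t f \<Longrightarrow> polyfun f"
  by (rule polyfunI) (rule cpoly_form)

text \<open>The quadric spans the space: if \<open>b y w0 \<noteq> 0\<close>, then \<open>y\<close>
  differs from a point of the quadric by a multiple of \<open>w0\<close>.\<close>

lemma psi_linear:
  assumes "form 1 l" "l y \<noteq> 0" shows "\<exists>x. l (psi x) \<noteq> 0"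
proof (rule ccontr)
  assume "\<not> ?thesis"
  then have W: "l p = 0" if "q p = 0" for p
    using psi_dense[OF polyfun_form[OF assms(1)] that] by blast
  have *: "l y = 0" if "b y w0 \<noteq> 0" for y
  proof -
    have "q (y - (q y / (2 * b y w0)) *s w0) = 0"
      using that w_simps by (simp add: q_simps b_simps)
    from W[OF this] show ?thesis using W[OF w_simps(1)] by (simp add: form_1_linear[OF assms(1)])
  qed
  show False
  proof (cases "b y w0 = 0")
    case True
    then have "l (y + e1) = 0" "l e1 = 0" using w_simps by (auto intro!: * simp: b_simps)
    then show False using assms(2) by (simp add: form_1_linear[OF assms(1)])
  qed (use * assms(2) in blast)
qed

lemma isotropic_basis: "\<exists>x. interp 1 {..<CARD('n)} (\<lambda>i. psi (x i))"
proof -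
  have "\<exists>x. interp 1 {..<k} (\<lambda>i. psi (x i))" if "k \<le> CARD('n)" for k
    using that
  proof (induction k)
    case 0
    show ?case by (auto simp: interp_def intro: form_0)
  next
    case (Suc k)
    then obtain x where x: "interp 1 {..<k} (\<lambda>i. psi (x i))" by auto
    have "card {..<k} < card (UNIV :: 'n set)" using Suc.prems by simp
    from interp_exchange[OF _ _ this interp_axis, of "\<lambda>i. psi (x i)"]
    obtain l y where l: "form 1 l" "\<forall>i\<in>{..<k}. l (psi (x i)) = 0" "l y \<noteq> 0" by auto
    obtain z where z: "l (psi z) \<noteq> 0" using psi_linear[OF l(1,3)] by blast
    have 1: "interp 1 {..<k} (\<lambda>i. psi ((x(k := z)) i))"
      using interp_cong[of "{..<k}" "\<lambda>i. psi ((x(k := z)) i)" "\<lambda>i. psi (x i)"] x by simp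
    have "interp 1 (insert k {..<k}) (\<lambda>i. psi ((x(k := z)) i))"
      by (rule interp_insert[OF 1 _ l(1)]) (use l(2) z in auto)
    then show ?case by (auto simp: lessThan_Suc)
  qed
  then show ?thesis by blast
qed

end

section \<open>Ratios of forms invariant under reflections\<close>

locale form_ratio = quadric A e1 e2 e3
  for A :: "complex^'n^'n" and e1 e2 e3 :: "complex^'n" +
  fixes t :: nat and f g :: "complex^'n \<Rightarrow> complex"
  assumes ff: "form t f" and fg: "form t g"
    and g_nz: "\<exists>w. q w = 0 \<and> g w \<noteq> 0"
begin

text \<open>\<open>rel x y\<close> expresses that \<open>f / g\<close> takes the same value at \<open>x\<close> and \<open>y\<close>, and \<open>inv u\<close> that
  \<open>f / g\<close> is invariant on the quadric under the reflection along \<open>u\<close>.\<close>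
definition rel where "rel x y \<longleftrightarrow> f x * g y = f y * g x"

definition inv where "inv u \<longleftrightarrow> (\<forall>p. q p = 0 \<longrightarrow> rel p (refl u p))"

lemma rel_trans:
  assumes "rel x y" "rel y z" "g y \<noteq> 0" shows "rel x z"
proof -
  have "(f x * g z) * g y = (f x * g y) * g z" by simp
  also have "\<dots> = (f y * g z) * g x" using assms(1) by (simp add: rel_def)
  also have "\<dots> = (f z * g x) * g y" using assms(2) by (simp add: rel_def)
  finally show ?thesis using assms(3) by (simp add: rel_def)
qed

lemma rel_scale: "c \<noteq> 0 \<Longrightarrow> rel x (c *s y) \<longleftrightarrow> rel x y"
  by (simp add: rel_def form_homogeneous[OF ff] form_homogeneous[OF fg])

lemma inv_scale: "c \<noteq> 0 \<Longrightarrow> inv (c *s u) \<longleftrightarrow> inv u"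
  by (simp add: inv_def refl_scale_left rel_scale)

lemma polyfun_refl: "polyfun \<phi> \<Longrightarrow> polyfun (\<lambda>p. \<phi> (refl u p))"
  by (rule polyfunI) (rule polyfun_comp[of \<phi>], auto intro: pcurve_refl pcurve_const)

lemma polyfun_mult: "polyfun \<phi> \<Longrightarrow> polyfun \<theta> \<Longrightarrow> polyfun (\<lambda>p. \<phi> p * \<theta> p)"
  by (rule polyfunI) (intro cpoly_mult polyfun_comp)

lemma polyfun_diff: "polyfun \<phi> \<Longrightarrow> polyfun \<theta> \<Longrightarrow> polyfun (\<lambda>p. \<phi> p - \<theta> p)"
  by (rule polyfunI) (intro cpoly_diff polyfun_comp)

text \<open>By \<open>refl_conj\<close> the new reflection is a composition of three known ones.
  Transitivity of \<open>rel\<close> requires \<open>g\<close> to be nonzero at the intermediate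
  points, so a supposed counterexample is first moved to a generic point of the quadric.\<close>

lemma inv_refl:
  assumes "q u \<noteq> 0" "q v \<noteq> 0" "inv u" "inv v" shows "inv (refl u v)"
proof (unfold inv_def, intro allI impI, rule ccontr)
  fix p0 assume p0: "q p0 = 0" "\<not> rel p0 (refl (refl u v) p0)"
  obtain w where w: "q w = 0" "g w \<noteq> 0" using g_nz by blast
  note pf = polyfun_form[OF ff] and pg = polyfun_form[OF fg]
  let ?r = "\<lambda>p. refl (refl u v) p"
  have P: "polyfun (\<lambda>p. f p * g (?r p) - f (?r p) * g p)"
    by (intro polyfun_diff polyfun_mult polyfun_refl[of _ "refl u v"] pf pg)
  have P0: "f p0 * g (?r p0) - f (?r p0) * g p0 \<noteq> 0" using p0(2) by (simp add: rel_def)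
  have 2: "polyfun (\<lambda>p. g (refl u p))" by (rule polyfun_refl[OF pg])
  have 3: "polyfun (\<lambda>p. g (refl v (refl u p)))" by (rule polyfun_refl[OF polyfun_refl[OF pg]])
  have n2: "g (refl u (refl u w)) \<noteq> 0"
    using w assms by (simp add: refl_refl form_homogeneous[OF fg])
  have n3: "g (refl v (refl u (refl u (refl v w)))) \<noteq> 0"
    using w assms by (simp add: refl_refl refl_scale_right form_homogeneous[OF fg])
  have z: "q (refl u w) = 0" "q (refl u (refl v w)) = 0" using w(1) by (simp_all add: q_refl)
  obtain x where x: "g (refl u (psi x)) \<noteq> 0" "g (refl v (refl u (psi x))) \<noteq> 0"
    using psi_dense2[OF 2 z(1) n2 3 z(2) n3] by blast
  have x': "g (refl u (psi x)) * g (refl v (refl u (psi x))) \<noteq> 0" using x by simp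
  obtain y where y: "f (psi y) * g (?r (psi y)) - f (?r (psi y)) * g (psi y) \<noteq> 0"
    "g (refl u (psi y)) * g (refl v (refl u (psi y))) \<noteq> 0"
    using psi_dense2[OF P p0(1) P0 polyfun_mult[OF 2 3] q_psi x'] by blast
  let ?p = "psi y"
  have "rel ?p (refl u ?p)" using assms(3) by (simp add: inv_def)
  moreover have "rel (refl u ?p) (refl v (refl u ?p))" using assms(4) by (simp add: inv_def q_refl)
  moreover have "rel (refl v (refl u ?p)) (?r ?p)"
    using assms(3) by (simp add: inv_def q_refl flip: refl_conj)
  ultimately have "rel ?p (?r ?p)" using y(2) rel_trans by (metis mult_eq_0_iff)
  then show False using y(1) by (simp add: rel_def)
qed

text \<open>One looks for \<open>u = u0 + s *s p\<close> such that reflecting \<open>y\<close> first along \<open>u\<close> and then along \<open>o'\<close>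
  leads back into \<open>U\<close>; this is a quadratic equation in \<open>s\<close>.\<close>
lemma inv_join_generic:
  assumes U: "vec.subspace U" "p \<in> U" "u0 \<in> U" "\<And>u. u \<in> U \<Longrightarrow> q u \<noteq> 0 \<Longrightarrow> inv u"
    and p: "q p = 0" and o': "inv o'" "q o' \<noteq> 0"
    and y: "y = u0 + z *s o'" "q y \<noteq> 0"
    and ne: "b p u0 \<noteq> 0" "b p y \<noteq> 0" "b o' p \<noteq> 0"
      "b ((2 * b p u0) *s u0 - q u0 *s p) y \<noteq> 0" "b ((2 * b p u0) *s u0 - q u0 *s p) o' \<noteq> 0"
  shows "inv y"
proof -
  \<comment> \<open>The coefficient of \<open>o'\<close> in \<open>refl o' (refl u y)\<close>
    vanishes iff \<open>4 * b u y * b o' u = q u * \<kappa>\<close>. As \<open>p\<close> is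
    isotropic, \<open>q u\<close> is linear in \<open>s\<close>, so the quadratic term has
    coefficient \<open>4 * b p y * b o' p\<close>.\<close>
  define \<kappa> where "\<kappa> = 2 * b o' u0 + z * q o'"
  have "4 * b p y * b o' p \<noteq> 0" using ne by simp
  then obtain s where s: "4 * b p y * b o' p * s\<^sup>2
      + (4 * b u0 y * b o' p + 4 * b p y * b o' u0 - 2 * b p u0 * \<kappa>) * s
      + (4 * b u0 y * b o' u0 - q u0 * \<kappa>) = 0"
    using complex_quadratic_root by blast
  define u where "u = u0 + s *s p"
  have uU: "u \<in> U" unfolding u_def using U by (intro vec.subspace_add vec.subspace_scale)
  have uy: "b u y = b u0 y + s * b p y" and ou: "b o' u = b o' u0 + s * b o' p"
    by (simp_all add: u_def b_simps)
  have qu: "q u = q u0 + 2 * s * b p u0"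
    by (simp add: u_def q_simps b_simps p b_sym[of u0 p])
  have eq: "4 * b u y * b o' u = q u * \<kappa>"
    using s unfolding uy ou qu by (simp add: algebra_simps power2_eq_square)
  \<comment> \<open>The one isotropic \<open>u\<close> on this line is proportional to the vector in
    the last two conditions of \<open>ne\<close>, which exclude it.\<close>
  have qu0: "q u \<noteq> 0"
  proof
    assume "q u = 0"
    then have e: "2 * b p u0 * s = - q u0" unfolding qu by (simp add: algebra_simps add_eq_0_iff)
    have "(2 * b p u0) *s u = (2 * b p u0) *s u0 + (2 * b p u0 * s) *s p"
      by (simp add: u_def vec.scale_right_distrib)
    also have "\<dots> = (2 * b p u0) *s u0 - q u0 *s p" unfolding e by simp
    finally have *: "(2 * b p u0) *s u = (2 * b p u0) *s u0 - q u0 *s p" .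
    have "b u y * b o' u = 0" using eq \<open>q u = 0\<close> by simp
    then have "b ((2 * b p u0) *s u) y = 0 \<or> b ((2 * b p u0) *s u) o' = 0"
      by (auto simp: b_left(3) b_sym[of u o'])
    then show False using ne unfolding * by blast
  qed
  define v where "v = q u *s u0 - (2 * b u y) *s u"
  have vU: "v \<in> U" unfolding v_def using U uU by (intro vec.subspace_diff vec.subspace_scale)
  have ry: "refl u y = v + (q u * z) *s o'"
    by (simp add: refl_def v_def y(1) vec.scale_right_distrib vec.scale_scale)
  have bov: "b o' v = q u * b o' u0 - 2 * b u y * b o' u" by (simp add: v_def b_simps)
  have "2 * b o' (refl u y) = q o' * (q u * z) + (q u * \<kappa> - 4 * b u y * b o' u)"
    unfolding ry b_right bov \<kappa>_def by (simp add: q_b algebra_simps)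
  then have bory: "2 * b o' (refl u y) = q o' * (q u * z)" unfolding eq by simp
  have "refl o' (refl u y) = q o' *s v + (q o' * (q u * z)) *s o' - (2 * b o' (refl u y)) *s o'"
    unfolding refl_def[of o'] by (subst (1) ry) (simp add: vec.scale_right_distrib vec.scale_scale)
  also have "\<dots> = q o' *s v" unfolding bory by simp
  finally have rr: "refl o' (refl u y) = q o' *s v" .
  have qx: "q (refl o' (refl u y)) \<noteq> 0" using qu0 o' y by (simp add: q_refl)
  have xU: "refl o' (refl u y) \<in> U" unfolding rr using U vU by (intro vec.subspace_scale)
  have "inv (refl o' (refl o' (refl u y)))" by (rule inv_refl[OF o'(2) qx o'(1) U(4)[OF xU qx]])
  then have "inv (refl u y)" using o'(2) by (simp add: refl_refl inv_scale)
  moreover have "q (refl u y) \<noteq> 0" using qu0 y(2) by (simp add: q_refl)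
  ultimately have "inv (refl u (refl u y))" using inv_refl[OF qu0 _ U(4)[OF uU qu0]] by blast
  then show ?thesis using qu0 by (simp add: refl_refl inv_scale)
qed

lemma inv_closed:
  assumes "pcurve \<gamma>" "finite {s. \<not> inv (\<gamma> s)}" shows "inv (\<gamma> s0)"
  unfolding inv_def
proof (intro allI impI)
  fix p assume p: "q p = 0"
  let ?h = "\<lambda>s. f p * g (refl (\<gamma> s) p) - f (refl (\<gamma> s) p) * g p"
  have c: "pcurve (\<lambda>s. refl (\<gamma> s) p)" using assms(1) by (intro poly_intros)
  have "cpoly ?h" by (intro cpoly_diff cpoly_mult cpoly_const cpoly_form[OF ff c] cpoly_form[OF fg c])
  moreover have "{s. ?h s \<noteq> 0} \<subseteq> {s. \<not> inv (\<gamma> s)}" using p by (auto simp: inv_def rel_def)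
  then have "finite {s. ?h s \<noteq> 0}" using assms(2) finite_subset by blast
  ultimately have "?h s0 = 0" by (rule cpoly_eq_0)
  then show "rel p (refl (\<gamma> s0) p)" by (simp add: rel_def)
qed

text \<open>On the line from \<open>r + z *s o'\<close> to \<open>u + c *s o'\<close> all but
  finitely many points satisfy the conditions of \<open>inv_join_generic\<close>;
  \<open>inv_closed\<close> then reaches the end point.\<close>

lemma inv_join:
  assumes U: "vec.subspace U" "p \<in> U" "r \<in> U" "\<And>u. u \<in> U \<Longrightarrow> q u \<noteq> 0 \<Longrightarrow> inv u"
    and pr: "q p = 0" "q r = 0" "b p r \<noteq> 0" and o': "inv o'" "q o' \<noteq> 0" "b o' p \<noteq> 0" "b o' r \<noteq> 0"
    and u: "u \<in> U" "q (u + c *s o') \<noteq> 0"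
  shows "inv (u + c *s o')"
proof -
  \<comment> \<open>Besides \<open>0\<close>, at most one value must be avoided, so \<open>1\<close>
    or \<open>2\<close> works.\<close>
  obtain z where z: "z \<noteq> 0" "b p r + z * b p o' \<noteq> 0"
  proof (cases "b p r + b p o' = 0")
    case True
    then have "b p r = - b p o'" by (simp add: eq_neg_iff_add_eq_0)
    then have "b p r + 2 * b p o' \<noteq> 0" using o'(3) b_sym[of p o'] by simp
    then show ?thesis using that[of 2] by simp
  qed (use that[of 1] in auto)
  define \<gamma> where "\<gamma> s = r + s *s (u - r)" for s
  define \<zeta> where "\<zeta> s = z + s * (c - z)" for s
  define y where "y s = \<gamma> s + \<zeta> s *s o'" for s
  define N where "N s = (2 * b p (\<gamma> s)) *s \<gamma> s - q (\<gamma> s) *s p" for s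
  have [poly_intros]: "pcurve \<gamma>" "cpoly \<zeta>" unfolding \<gamma>_def \<zeta>_def by (intro poly_intros)+
  have [poly_intros]: "pcurve y" "pcurve N" unfolding y_def N_def by (intro poly_intros)+
  have y0: "y 0 = r + z *s o'" "N 0 = (2 * b p r) *s r" "\<gamma> 0 = r"
    by (simp_all add: y_def \<gamma>_def \<zeta>_def N_def pr)
  have y1: "y 1 = u + c *s o'" by (simp add: y_def \<gamma>_def \<zeta>_def)
  have sym: "b r o' = b o' r" "b p o' = b o' p" by (rule b_sym)+
  have "finite {s. b p (\<gamma> s) = 0}" by (rule cpoly_finite_zeros[of _ 0]) (intro poly_intros, simp add: y0 pr)
  moreover have "finite {s. b p (y s) = 0}"
    by (rule cpoly_finite_zeros[of _ 0]) (intro poly_intros, use z in \<open>simp add: y0 b_simps\<close>)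
  moreover have "finite {s. b (N s) (y s) = 0}"
    by (rule cpoly_finite_zeros[of _ 0])
       (intro poly_intros, use z pr o' in \<open>simp add: y0 b_simps sym q_b[symmetric]\<close>)
  moreover have "finite {s. b (N s) o' = 0}"
    by (rule cpoly_finite_zeros[of _ 0]) (intro poly_intros, use pr o' in \<open>simp add: y0 b_simps sym\<close>)
  moreover have "finite {s. q (y s) = 0}"
    by (rule cpoly_finite_zeros[of _ 1]) (intro poly_intros, use u in \<open>simp add: y1\<close>)
  ultimately have fin: "finite ({s. b p (\<gamma> s) = 0} \<union> {s. b p (y s) = 0} \<union> {s. b (N s) (y s) = 0}
      \<union> {s. b (N s) o' = 0} \<union> {s. q (y s) = 0})" by blast
  have inv: "inv (y s)" if "b p (\<gamma> s) \<noteq> 0" "b p (y s) \<noteq> 0" "b (N s) (y s) \<noteq> 0"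
    "b (N s) o' \<noteq> 0" "q (y s) \<noteq> 0" for s
  proof (rule inv_join_generic[OF U(1,2) _ U(4) pr(1) o'(1,2) _ that(5) that(1,2) o'(3)])
    show "\<gamma> s \<in> U" unfolding \<gamma>_def using U u by (intro vec.subspace_add vec.subspace_scale vec.subspace_diff)
    show "y s = \<gamma> s + \<zeta> s *s o'" by (simp add: y_def)
  qed (use that in \<open>simp_all add: N_def\<close>)
  have "finite {s. \<not> inv (y s)}" by (rule finite_subset[OF _ fin]) (use inv in blast)
  then show ?thesis using inv_closed[of y 1] y1 by (simp add: poly_intros)
qed

lemma inv_span:
  assumes pr: "q p = 0" "q r = 0" "b p r \<noteq> 0"
    and base: "\<And>u. u \<in> vec.span {p, r} \<Longrightarrow> q u \<noteq> 0 \<Longrightarrow> inv u"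
    and S: "finite S" "\<And>o'. o' \<in> S \<Longrightarrow> inv o' \<and> q o' \<noteq> 0 \<and> b o' p \<noteq> 0 \<and> b o' r \<noteq> 0"
    and "y \<in> vec.span ({p, r} \<union> S)" "q y \<noteq> 0"
  shows "inv y"
  using S assms(7,8)
proof (induction S arbitrary: y rule: finite_induct)
  case empty
  then show ?case using base by simp
next
  case (insert o' S)
  let ?U = "vec.span ({p, r} \<union> S)"
  obtain c where c: "y - c *s o' \<in> ?U"
    using insert.prems(2) by (metis Un_insert_right vec.span_breakdown_eq)
  have "inv ((y - c *s o') + c *s o')"
  proof (rule inv_join[of ?U p r])
    show "inv u" if "u \<in> ?U" "q u \<noteq> 0" for u using insert.IH insert.prems(1) that by blast
    show "p \<in> ?U" "r \<in> ?U" by (auto intro: vec.span_base)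
  qed (use insert.prems c pr in auto)
  then show ?case by simp
qed

text \<open>Two points \<open>p\<close>, \<open>p'\<close> of the quadric with \<open>b p p' \<noteq> 0\<close> are exchanged by the reflection along
  \<open>p - p'\<close>.\<close>
lemma rel_all:
  assumes "\<And>y. q y \<noteq> 0 \<Longrightarrow> inv y" "q p = 0" "q p' = 0" shows "rel p p'"
proof (rule ccontr)
  assume n: "\<not> rel p p'"
  note pf = polyfun_form[OF ff] and pg = polyfun_form[OF fg]
  have pb: "polyfun (b x)" for x by (rule polyfunI) (intro poly_intros)
  have 1: "polyfun (\<lambda>x. f x * g p' - f p' * g x)"
    by (intro polyfun_diff polyfun_mult pf pg) (auto intro!: polyfunI poly_intros)
  have "f p * g p' - f p' * g p \<noteq> 0" "b w0 w1 \<noteq> 0" using n w_simps by (auto simp: rel_def)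
  \<comment> \<open>The second condition ensures that \<open>b (psi x)\<close> is not identically
    zero on the quadric, as needed to choose \<open>y\<close>.\<close>
  then obtain x where x: "f (psi x) * g p' - f p' * g (psi x) \<noteq> 0" "b w0 (psi x) \<noteq> 0"
    using psi_dense2[OF 1 assms(2) _ pb w_simps(2)] by blast
  have 2: "polyfun (\<lambda>y. f (psi x) * g y - f y * g (psi x))"
    by (intro polyfun_diff polyfun_mult pf pg) (auto intro!: polyfunI poly_intros)
  have x2: "b (psi x) w0 \<noteq> 0" using x(2) b_sym[of "psi x" w0] by simp
  obtain y where y: "f (psi x) * g (psi y) - f (psi y) * g (psi x) \<noteq> 0" "b (psi x) (psi y) \<noteq> 0"
    using psi_dense2[OF 2 assms(3) x(1) pb w_simps(1) x2] by blast
  let ?p = "psi x" and ?p' = "psi y"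
  have q: "q (?p - ?p') = - 2 * b ?p ?p'" by (simp add: q_simps)
  then have "inv (?p - ?p')" using assms(1) y(2) by simp
  then have "rel ?p (refl (?p - ?p') ?p)" by (simp add: inv_def)
  moreover have "refl (?p - ?p') ?p = (- 2 * b ?p ?p') *s ?p'"
    unfolding refl_def q by (simp add: b_simps b_sym[of ?p' ?p] q_b[symmetric] vec_eq_iff algebra_simps)
  ultimately have "rel ?p ?p'" using y(2) rel_scale[of "- 2 * b ?p ?p'" ?p ?p'] by simp
  then show False using y(1) by (simp add: rel_def)
qed

end

section \<open>Generic chains of lines\<close>

text \<open>Starting node, parameters fed to \<open>psi\<close>, and positions of the next nodes. No
  equation constrains them, so any two configurations are joined by a line; infinite sequences serve
  chains of all lengths.\<close>

type_synonym 'n config = "(complex^'n) \<times> (nat \<Rightarrow> complex^'n) \<times> (nat \<Rightarrow> complex)"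

definition lin :: "'n config \<Rightarrow> 'n config \<Rightarrow> complex \<Rightarrow> 'n::finite config" where
  "lin c c' s = (fst c + s *s (fst c' - fst c),
     (\<lambda>k. fst (snd c) k + s *s (fst (snd c') k - fst (snd c) k)),
     (\<lambda>k. snd (snd c) k + s * (snd (snd c') k - snd (snd c) k)))"

lemma lin_0_1: "lin c c' 0 = c" "lin c c' 1 = c'"
  by (simp_all add: lin_def)

text \<open>Substitutes for ``Zariski open'' and ``Zariski open and nonempty'', tested on lines in the space
  of configurations.\<close>
definition zopen :: "('n::finite config \<Rightarrow> bool) \<Rightarrow> bool" where
  "zopen G \<longleftrightarrow> (\<forall>c c' s0. G (lin c c' s0) \<longrightarrow> finite {s. \<not> G (lin c c' s)})"

definition gen :: "('n::finite config \<Rightarrow> bool) \<Rightarrow> bool" where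
  "gen G \<longleftrightarrow> zopen G \<and> (\<exists>c. G c)"

lemma zopenI: "(\<And>c c' s0. G (lin c c' s0) \<Longrightarrow> finite {s. \<not> G (lin c c' s)}) \<Longrightarrow> zopen G"
  by (auto simp: zopen_def)

lemma genI: "zopen G \<Longrightarrow> G c \<Longrightarrow> gen G"
  unfolding gen_def by blast

lemma gen_ex: "gen G \<Longrightarrow> \<exists>c. G c"
  unfolding gen_def by blast

text \<open>On the line joining a witness of \<open>G\<close> to one of \<open>H\<close>, each
  condition fails only finitely often.\<close>

lemma gen_conj:
  assumes "gen G" "gen H" shows "gen (\<lambda>c. G c \<and> H c)"
proof -
  have fin: "finite {s. \<not> (G (lin c c' s) \<and> H (lin c c' s))}"
    if "G (lin c c' s0)" "H (lin c c' s1)" for c c' s0 s1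
  proof -
    have "finite {s. \<not> G (lin c c' s)}" "finite {s. \<not> H (lin c c' s)}"
      using assms that unfolding gen_def zopen_def by blast+
    moreover have "{s. \<not> (G (lin c c' s) \<and> H (lin c c' s))} = {s. \<not> G (lin c c' s)} \<union> {s. \<not> H (lin c c' s)}"
      by blast
    ultimately show ?thesis by simp
  qed
  obtain c c' where "G c" "H c'" using assms by (auto simp: gen_def)
  then have "finite {s. \<not> (G (lin c c' s) \<and> H (lin c c' s))}"
    using fin[of c c' 0 1] by (simp add: lin_0_1)
  then obtain s where "G (lin c c' s) \<and> H (lin c c' s)"
    using cofinite_complex_ex[of "\<lambda>s. G (lin c c' s) \<and> H (lin c c' s)"] by blast
  moreover have "zopen (\<lambda>c. G c \<and> H c)" by (rule zopenI) (use fin in blast)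
  ultimately show ?thesis by (rule genI[rotated])
qed

lemma gen_True: "gen (\<lambda>c. True)"
  by (simp add: gen_def zopen_def)

lemma gen_ball: "finite I \<Longrightarrow> (\<And>i. i \<in> I \<Longrightarrow> gen (G i)) \<Longrightarrow> gen (\<lambda>c. \<forall>i\<in>I. G i c)"
  by (induction I rule: finite_induct) (simp_all add: gen_True gen_conj)

lemma zopen_nonzero:
  assumes "\<And>c c'. cpoly (\<lambda>s. \<phi> (lin c c' s))" shows "zopen (\<lambda>c. \<phi> c \<noteq> 0)"
proof (rule zopenI)
  fix c c' s0 assume "\<phi> (lin c c' s0) \<noteq> 0"
  from cpoly_finite_zeros[OF assms this] show "finite {s. \<not> \<phi> (lin c c' s) \<noteq> 0}" by simp
qed

lemma zopen_interp:
  assumes "finite I" "\<And>i c c'. i \<in> I \<Longrightarrow> pcurve (\<lambda>s. v (lin c c' s) i)"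
  shows "zopen (\<lambda>c. interp t I (v c))"
proof (rule zopenI)
  fix c c' s0 assume "interp t I (v (lin c c' s0))"
  then show "finite {s. \<not> interp t I (v (lin c c' s))}"
    using interp_cofinite[OF assms(1), of "\<lambda>i s. v (lin c c' s) i" t s0] assms(2) by simp
qed

context quadric
begin

text \<open>Line number \<open>k\<close> of the chain passes through \<open>node c k\<close> and \<open>node c (Suc k)\<close>; it meets the
  quadric in \<open>P c k\<close> and \<open>R c k\<close>. Consecutive nodes may coincide, in which case lines
  number \<open>k - 1\<close>, \<open>k\<close> and \<open>k + 1\<close> are concurrent.\<close>
definition P where "P c k = psi (fst (snd c) k)"

primrec node where
  "node c 0 = fst c"
| "node c (Suc k) = node c k + snd (snd c) k *s P c k"

definition R where "R c k = refl (node c k) (P c k)"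

definition pt where "pt c i = (if snd i then R c (fst i) else P c (fst i))"

lemma pt_simps: "pt c (k, False) = P c k" "pt c (k, True) = R c k"
  by (simp_all add: pt_def)

lemma q_P: "q (P c k) = 0" by (simp add: P_def)

lemma q_R: "q (R c k) = 0" by (simp add: R_def q_refl q_P)

lemma q_pt: "q (pt c i) = 0" by (simp add: pt_def q_P q_R)

lemma b_P_R: "b (P c k) (R c k) = - 2 * (b (node c k) (P c k))\<^sup>2"
  by (simp add: R_def refl_def b_simps q_P flip: q_b) (simp add: power2_eq_square b_sym)

lemma pcurve_lin_fst [poly_intros]: "pcurve (\<lambda>s. fst (lin c c' s))"
  unfolding lin_def fst_conv by (intro poly_intros)

lemma pcurve_lin_P [poly_intros]: "pcurve (\<lambda>s. P (lin c c' s) k)"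
  unfolding lin_def P_def fst_conv snd_conv by (intro poly_intros)

lemma cpoly_lin_snd [poly_intros]: "cpoly (\<lambda>s. snd (snd (lin c c' s)) k)"
  unfolding lin_def snd_conv by (intro poly_intros)

lemma pcurve_lin_node [poly_intros]: "pcurve (\<lambda>s. node (lin c c' s) k)"
  by (induction k) (auto intro!: poly_intros)

lemma pcurve_lin_R [poly_intros]: "pcurve (\<lambda>s. R (lin c c' s) k)"
  unfolding R_def by (intro poly_intros)

lemma pcurve_lin_pt [poly_intros]: "pcurve (\<lambda>s. pt (lin c c' s) i)"
  unfolding pt_def by (cases "snd i") (auto intro!: poly_intros)

lemma zopen_interp_pt: "finite I \<Longrightarrow> zopen (\<lambda>c. interp t I (pt c))"
  by (rule zopen_interp) (auto intro: poly_intros)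

lemma node_cong:
  "fst c = fst c' \<Longrightarrow> (\<And>i. i < k \<Longrightarrow> P c i = P c' i \<and> snd (snd c) i = snd (snd c') i) \<Longrightarrow> node c k = node c' k"
  by (induction k) simp_all

lemma node_const: "(\<And>i. i < k \<Longrightarrow> snd (snd c) i = 0) \<Longrightarrow> node c k = fst c"
  by (induction k) simp_all

lemma gen_node:
  "gen (\<lambda>c. q (node c k) \<noteq> 0)" "gen (\<lambda>c. b (node c k) (P c m) \<noteq> 0)"
  "gen (\<lambda>c. b (node c k) (R c m) \<noteq> 0)"
proof -
  obtain x where x: "b e1 (psi x) \<noteq> 0" using psi_linear[OF form_b, of e1 e1] orth by auto
  \<comment> \<open>Zero coefficients keep every node at \<open>e1\<close>, so all the lines of this
    witness coincide.\<close>
  let ?c = "(e1, (\<lambda>_. x), (\<lambda>_. 0::complex))"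
  have n: "node ?c k = e1" for k using node_const[of k ?c] by simp
  have q: "q e1 = 1" using orth by (simp add: q_b)
  show "gen (\<lambda>c. q (node c k) \<noteq> 0)"
    by (rule genI[of _ ?c], intro zopen_nonzero poly_intros, simp add: n q)
  show "gen (\<lambda>c. b (node c k) (P c m) \<noteq> 0)"
    by (rule genI[of _ ?c], intro zopen_nonzero poly_intros, simp add: n x P_def)
  show "gen (\<lambda>c. b (node c k) (R c m) \<noteq> 0)"
    by (rule genI[of _ ?c], intro zopen_nonzero poly_intros)
       (use x orth in \<open>simp add: n P_def R_def refl_def b_simps q\<close>)
qed

lemma gen_coeff: "gen (\<lambda>c. snd (snd c) k \<noteq> 0)"
  by (rule genI[of _ "(0, \<lambda>_. 0, \<lambda>_. 1)"], intro zopen_nonzero poly_intros, simp)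

lemma gen_basis:
  assumes "finite K" "card K < CARD('n)"
  shows "gen (\<lambda>c. interp 1 (insert None (Some ` K)) (\<lambda>i. case i of None \<Rightarrow> fst c | Some k \<Rightarrow> P c k))"
proof -
  have zo: "zopen (\<lambda>c. interp 1 (insert None (Some ` K)) (\<lambda>i. case i of None \<Rightarrow> fst c | Some k \<Rightarrow> P c k))"
    by (rule zopen_interp) (use assms in \<open>auto intro!: poly_intros split: option.split\<close>)
  obtain x where x: "interp 1 {..<CARD('n)} (\<lambda>i. psi (x i))" using isotropic_basis by blast
  have "card (insert None (Some ` K)) \<le> card {..<CARD('n)}"
    using assms by (simp add: card_image)
  then obtain h where h: "h ` insert None (Some ` K) \<subseteq> {..<CARD('n)}" "inj_on h (insert None (Some ` K))"
    using card_le_inj[of "insert None (Some ` K)" "{..<CARD('n)}"] assms(1) by auto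
  let ?c = "(psi (x (h None)), (\<lambda>k. x (h (Some k))), (\<lambda>_. 0::complex))"
  have "interp 1 (insert None (Some ` K)) (\<lambda>i. case i of None \<Rightarrow> fst ?c | Some k \<Rightarrow> P ?c k)"
    by (rule interp_reindex[OF x h]) (auto simp: P_def)
  with zo show ?thesis by (rule genI)
qed

text \<open>For lines through one centre the dual forms are \<open>l ^ (t - 1) * m\<close>: the
  linear form \<open>l\<close> vanishes on all lines but number \<open>k\<close>, and
  \<open>m\<close> separates the two points of that line. The power of \<open>l\<close> must be
  positive, whence \<open>t \<ge> 2\<close>.\<close>

lemma star_interp:
  assumes K: "finite K" "card K < CARD('n)" and t: "t \<ge> 2"
  shows "gen (\<lambda>c. interp t (K \<times> UNIV) (pt c))"
proof -
  have "gen (\<lambda>c. interp 1 (insert None (Some ` K)) (\<lambda>i. case i of None \<Rightarrow> fst c | Some k \<Rightarrow> P c k) \<and>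
      (q (node c 0) \<noteq> 0 \<and> (\<forall>k\<in>K. b (node c 0) (P c k) \<noteq> 0)))"
    by (intro gen_conj gen_basis gen_node gen_ball K)
  from gen_ex[OF this] obtain c where c: "interp 1 (insert None (Some ` K)) (\<lambda>i. case i of None \<Rightarrow> fst c | Some k \<Rightarrow> P c k)"
    "q (node c 0) \<noteq> 0" "\<forall>k\<in>K. b (node c 0) (P c k) \<noteq> 0" by blast
  note c = c(1) c(2,3)[unfolded node.simps]
  define o' where "o' = fst c"
  define c0 where "c0 = (o', fst (snd c), (\<lambda>_::nat. 0::complex))"
  have P0: "P c0 k = P c k" and R0: "R c0 k = q o' *s P c k - (2 * b o' (P c k)) *s o'" for k
    using node_const[of k c0] by (simp_all add: P_def R_def c0_def refl_def)
  have lin: "\<exists>l. form 1 l \<and> l o' = a \<and> (\<forall>k\<in>K. l (P c k) = \<beta> k)" for a \<beta>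
  proof -
    obtain l where "form 1 l"
      "\<And>i. i \<in> insert None (Some ` K) \<Longrightarrow> l (case i of None \<Rightarrow> fst c | Some k \<Rightarrow> P c k) = (case i of None \<Rightarrow> a | Some k \<Rightarrow> \<beta> k)"
      using interpE[OF c(1), of "\<lambda>i. case i of None \<Rightarrow> a | Some k \<Rightarrow> \<beta> k"] by blast
    from this(1) this(2)[of None] this(2)[of "Some k" for k] show ?thesis
      by (intro exI[of _ l]) (auto simp: o'_def)
  qed
  have "interp t (K \<times> UNIV) (pt c0)"
  proof (rule interpI_dual)
    show "finite (K \<times> (UNIV :: bool set))" using K by simp
    fix i assume i: "i \<in> K \<times> (UNIV :: bool set)"
    obtain k bb where kb: "i = (k, bb)" "k \<in> K" using i by auto
    obtain l where l: "form 1 l" "l o' = 0" "\<forall>j\<in>K. l (P c j) = (if j = k then 1 else 0)"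
      using lin[of 0 "\<lambda>j. if j = k then 1 else 0"] by blast
    \<comment> \<open>\<open>m\<close> must vanish at the other point of line \<open>k\<close>. If
      that is \<open>P\<close>, its values are \<open>0\<close> at \<open>P\<close> and
      \<open>1\<close> at the centre; if it is \<open>R\<close>, they are chosen to cancel in the
      formula \<open>R0\<close>.\<close>
    obtain m where m: "form 1 m" "m o' = (if bb then 1 else q o')"
        "\<forall>j\<in>K. m (P c j) = (if bb then 0 else 2 * b o' (P c j))"
      using lin[of "if bb then 1 else q o'" "\<lambda>j. if bb then 0 else 2 * b o' (P c j)"] by blast
    let ?f = "\<lambda>x. l x ^ (t - 1) * m x"
    have lp: "l (P c0 j) = (if j = k then 1 else 0)" "l (R c0 j) = (if j = k then q o' else 0)" if "j \<in> K" for j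
      using l that unfolding P0 R0 by (auto simp: form_1_linear[OF l(1)])
    have mp: "m (pt c0 (k, bb)) \<noteq> 0" "m (pt c0 (k, \<not> bb)) = 0"
      using m kb c(3) unfolding pt_def P0 R0
      by (cases bb; simp add: form_1_linear[OF m(1)] o'_def P0 R0)+
    have "form (((t - 1) * 1) + 1) ?f" by (intro form_mult form_power l m)
    then have "form t ?f" using t by simp
    moreover have "?f (pt c0 i) \<noteq> 0" using mp(1) lp[of k] kb c(2)
      by (cases bb) (auto simp: pt_def o'_def)
    moreover have "?f (pt c0 j) = 0" if "j \<in> K \<times> UNIV" "j \<noteq> i" for j
    proof (cases "fst j = k")
      case True
      then have "j = (k, \<not> bb)" using that kb by (cases j) auto
      then show ?thesis using mp(2) by simp
    next
      case False
      then have "l (pt c0 j) = 0" using lp[of "fst j"] that by (auto simp: pt_def)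
      then show ?thesis using t by simp
    qed
    ultimately show "\<exists>f. form t f \<and> f (pt c0 i) \<noteq> 0 \<and> (\<forall>j\<in>K \<times> UNIV. j \<noteq> i \<longrightarrow> f (pt c0 j) = 0)"
      by blast
  qed
  then show ?thesis using zopen_interp_pt[of "K \<times> UNIV" t] K by (intro genI[of _ c0]) auto
qed

text \<open>The new line has coefficient \<open>0\<close>, so nodes \<open>i\<close> and
  \<open>Suc i\<close> coincide and all old lines survive, with shifted numbers.\<close>

definition ins where
  "ins c i z = (fst c,
     (\<lambda>k. if k < i then fst (snd c) k else if k = i then z else fst (snd c) (k - 1)),
     (\<lambda>k. if k < i then snd (snd c) k else if k = i then 0 else snd (snd c) (k - 1)))"

lemma P_ins: "P (ins c i z) k = (if k < i then P c k else if k = i then psi z else P c (k - 1))"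
  by (simp add: P_def ins_def)

lemma node_ins: "node (ins c i z) k = (if k \<le> i then node c k else node c (k - 1))"
proof (induction k)
  case 0
  show ?case by (simp add: ins_def)
next
  case (Suc k)
  show ?case
  proof (cases "k > i")
    case True
    then obtain k' where "k = Suc k'" by (cases k) auto
    then show ?thesis using Suc True by (simp add: P_ins) (simp add: ins_def)
  next
    case False
    then show ?thesis using Suc by (auto simp: P_ins) (auto simp: ins_def)
  qed
qed

lemma pt_ins: "k \<noteq> i \<Longrightarrow> pt (ins c i z) (k, bb) = pt c (if k < i then k else k - 1, bb)"
  by (cases bb) (auto simp: pt_def R_def node_ins P_ins)

text \<open>The case \<open>i = j\<close> attaches the new line at the free end of the
  chain.\<close>

lemma interp_ins:
  assumes "interp t ({..<j} \<times> UNIV) (pt c)" "i \<le> j"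
    and f: "form t f" "\<And>k. k \<in> {..<j} \<times> UNIV \<Longrightarrow> f (pt c k) = 0"
    and g: "form t g" "\<And>k. k \<in> {..<j} \<times> UNIV \<Longrightarrow> g (pt c k) = 0"
    and ne: "f (psi z) * g (refl (node c i) (psi z)) \<noteq> f (refl (node c i) (psi z)) * g (psi z)"
  shows "interp t ({..<Suc j} \<times> UNIV) (pt (ins c i z))"
proof -
  let ?I = "({..<Suc j} - {i}) \<times> (UNIV :: bool set)"
  let ?h = "\<lambda>(k, bb :: bool). (if k < i then k else k - 1, bb)"
  have hI: "?h ` ?I \<subseteq> {..<j} \<times> UNIV" using assms(2) by auto
  have pth: "pt (ins c i z) k = pt c (?h k)" if "k \<in> ?I" for k
    using that pt_ins[of "fst k" i c z "snd k"] by (cases k) auto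
  have 1: "interp t ?I (pt (ins c i z))"
    by (rule interp_reindex[OF assms(1) hI _ pth]) (auto intro!: inj_onI split: if_splits)
  have "interp t (insert (i, True) (insert (i, False) ?I)) (pt (ins c i z))"
  proof (rule interp_insert2[OF 1 _ _ _ f(1) _ g(1)])
    show "f (pt (ins c i z) k) = 0" "g (pt (ins c i z) k) = 0" if "k \<in> ?I" for k
      using f(2) g(2) pth[OF that] hI that by auto
    show "f (pt (ins c i z) (i, False)) * g (pt (ins c i z) (i, True)) \<noteq>
      f (pt (ins c i z) (i, True)) * g (pt (ins c i z) (i, False))"
      using ne by (simp add: pt_def R_def node_ins P_ins)
  qed auto
  moreover have "insert (i, True) (insert (i, False) ?I) = {..<Suc j} \<times> UNIV"
    using assms(2) by (auto simp: UNIV_bool)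
  ultimately show ?thesis by simp
qed

end

lemma (in form_ratio) inv_psi:
  assumes "\<And>z. rel (psi z) (refl u (psi z))" shows "inv u"
  unfolding inv_def
proof (intro allI impI, rule ccontr)
  fix p assume p: "q p = 0" "\<not> rel p (refl u p)"
  have "polyfun (\<lambda>p. f p * g (refl u p) - f (refl u p) * g p)"
    by (intro polyfun_diff polyfun_mult polyfun_refl[of _ u] polyfun_form[OF ff] polyfun_form[OF fg])
  from psi_dense[OF this p(1)] p(2) assms show False by (auto simp: rel_def)
qed

context quadric
begin

text \<open>If no insertion of a line at a node, or at a point of the last line, imposes two further
  conditions, then the ratio of two forms vanishing on all points is invariant under the reflections
  along these points, hence constant.\<close>
lemma chain_step:
  assumes gen: "gen (\<lambda>c. interp t ({..<j} \<times> UNIV) (pt c))" and j: "j \<ge> 1" "CARD('n) \<le> Suc j"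
    and Y: "finite Y" "2 * j + 2 \<le> card Y" "\<And>y. y \<in> Y \<Longrightarrow> q y = 0" "interp t Y (\<lambda>y. y)"
  shows "gen (\<lambda>c. interp t ({..<Suc j} \<times> UNIV) (pt c))"
proof (rule ccontr)
  assume "\<not> ?thesis"
  then have no: "\<not> interp t ({..<Suc j} \<times> UNIV) (pt c)" for c
    using genI[OF zopen_interp_pt[of "{..<Suc j} \<times> UNIV" t], of c] by auto
  define K where "K = {..<CARD('n) - 1}"
  define l where "l = j - 1"
  have K: "finite K" "card K < CARD('n)" "K \<subseteq> {..<j}" using j by (auto simp: K_def)
  have l: "j = Suc l" "l < j" using j by (auto simp: l_def)
  define I where "I = {..<j} \<times> (UNIV :: bool set)"
  have I: "finite I" "card I = 2 * j" by (simp_all add: I_def card_cartesian_product)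
  have "gen (\<lambda>c. interp t I (pt c) \<and>
      interp 1 (insert None (Some ` K)) (\<lambda>i. case i of None \<Rightarrow> fst c | Some k \<Rightarrow> P c k) \<and>
      (\<forall>k\<in>{..<j}. q (node c k) \<noteq> 0) \<and> (\<forall>k\<in>{..<j}. b (node c k) (P c l) \<noteq> 0) \<and>
      (\<forall>k\<in>{..<j}. b (node c k) (R c l) \<noteq> 0) \<and> (\<forall>k\<in>{..<j}. snd (snd c) k \<noteq> 0))"
    unfolding I_def by (intro gen_conj gen gen_basis gen_ball gen_node gen_coeff K(1,2) finite_lessThan)
  from gen_ex[OF this] obtain c where c: "interp t I (pt c)"
      "interp 1 (insert None (Some ` K)) (\<lambda>i. case i of None \<Rightarrow> fst c | Some k \<Rightarrow> P c k)"
    and node: "\<And>k. k < j \<Longrightarrow> q (node c k) \<noteq> 0" "\<And>k. k < j \<Longrightarrow> b (node c k) (P c l) \<noteq> 0"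
      "\<And>k. k < j \<Longrightarrow> b (node c k) (R c l) \<noteq> 0" "\<And>k. k < j \<Longrightarrow> snd (snd c) k \<noteq> 0"
    by (auto simp del: split_paired_Ex)
  \<comment> \<open>\<open>Y\<close> exceeds \<open>I\<close> by at least two points. This gives
    \<open>f\<close> with \<open>f y0 \<noteq> 0\<close> and, with \<open>y0\<close> as an
    additional zero, \<open>g\<close> with \<open>g y1 \<noteq> 0\<close>; hence
    \<open>f / g\<close> is not constant on the quadric.\<close>
  have "card I < card Y" using I Y by simp
  from interp_exchange[OF I(1) Y(1) this Y(4), of "pt c"]
  obtain f y0 where f: "form t f" "\<forall>i\<in>I. f (pt c i) = 0" "y0 \<in> Y" "f y0 \<noteq> 0" by blast
  let ?v = "case_option y0 (pt c)"
  have "card (insert None (Some ` I)) < card Y" using I Y(2) by (simp add: card_image)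
  from interp_exchange[OF _ Y(1) this Y(4), of ?v] I(1)
  obtain g y1 where "form t g" "\<forall>i\<in>insert None (Some ` I). g (?v i) = 0" "y1 \<in> Y" "g y1 \<noteq> 0"
    by auto
  then have g: "form t g" "\<forall>i\<in>I. g (pt c i) = 0" "g y0 = 0" "y1 \<in> Y" "g y1 \<noteq> 0" by auto
  interpret form_ratio A e1 e2 e3 t f g
    by unfold_locales (use f g Y(3) in auto)
  have inv_node: "inv (node c' i)"
    if "\<And>k. k \<in> I \<Longrightarrow> pt c' k = pt c k" "i \<le> j" for c' i
  proof (rule inv_psi, rule ccontr)
    fix z assume z: "\<not> rel (psi z) (refl (node c' i) (psi z))"
    have c': "interp t ({..<j} \<times> UNIV) (pt c')"
      using c(1) that(1) interp_cong[of I "pt c'" "pt c" t] unfolding I_def by blast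
    have "interp t ({..<Suc j} \<times> UNIV) (pt (ins c' i z))"
      by (rule interp_ins[OF c' that(2) f(1) _ g(1)])
         (use f(2) g(2) that(1) z in \<open>auto simp: rel_def I_def\<close>)
    then show False using no by blast
  qed
  define p where "p = P c l"
  define r where "r = R c l"
  define o' where "o' = node c l"
  have r: "r = q o' *s p - (2 * b o' p) *s o'" by (simp add: r_def R_def refl_def o'_def p_def)
  have op: "b o' p \<noteq> 0" "q o' \<noteq> 0" using node l by (auto simp: o'_def p_def)
  have pr: "q p = 0" "q r = 0" "b p r \<noteq> 0"
    using op by (simp_all add: p_def r_def q_P q_R b_P_R o'_def)
  \<comment> \<open>Coefficient number \<open>l\<close> affects no point of the first
    \<open>j\<close> lines; it only moves node \<open>j\<close> along the last line. Every direction
    in that line except \<open>p\<close> is reached this way, and \<open>p\<close> is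
    isotropic.\<close>
  have base: "inv u" if u': "u \<in> vec.span {p, r}" "q u \<noteq> 0" for u
  proof -
    obtain a where "u - a *s p \<in> vec.span {r}" using u'(1) vec.span_breakdown_eq[of u p "{r}"] by blast
    then obtain d where "u - a *s p = d *s r" by (auto simp: vec.span_singleton)
    then have "u = a *s p + d *s r" by (simp add: algebra_simps)
    then have u: "u = (a + d * q o') *s p + (- (2 * d * b o' p)) *s o'"
      unfolding r by (simp add: vec_eq_iff algebra_simps)
    have d: "d \<noteq> 0" using that(2) unfolding u by (auto simp: q_simps pr)
    define \<beta> where "\<beta> = - (2 * d * b o' p)"
    have \<beta>: "\<beta> \<noteq> 0" using d op by (simp add: \<beta>_def)
    define c' where "c' = (fst c, fst (snd c), (snd (snd c))(l := (a + d * q o') / \<beta>))"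
    have nc: "node c' k = node c k" if "k \<le> l" for k
      by (rule node_cong) (use that in \<open>auto simp: c'_def P_def\<close>)
    have "inv (node c' j)"
    proof (rule inv_node)
      show "pt c' k = pt c k" if "k \<in> I" for k
        using that l nc[of "fst k"] by (auto simp: I_def pt_def R_def) (auto simp: P_def c'_def)
    qed simp
    moreover have "\<beta> *s node c' j = u"
      unfolding l(1) node.simps nc[OF order.refl] using \<beta>
      by (simp add: u \<beta>_def[symmetric] o'_def[symmetric]) (simp add: c'_def P_def p_def vec_eq_iff field_simps)
    ultimately show ?thesis using inv_scale[OF \<beta>] by metis
  qed
  define S where "S = node c ` {..<j}"
  let ?U = "vec.span ({p, r} \<union> S)"
  have nodeU: "node c k \<in> ?U" if "k < j" for k using that by (intro vec.span_base) (auto simp: S_def)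
  \<comment> \<open>\<open>P c k\<close> is a multiple of a difference of consecutive nodes. For
    \<open>k = l\<close> the second node need not lie in \<open>S\<close>, but there the point is
    \<open>p\<close>.\<close>
  have PU: "P c k \<in> ?U" if "k < j" for k
  proof (cases "k = l")
    case True
    then show ?thesis by (intro vec.span_base) (auto simp: p_def)
  next
    case False
    then have "node c (Suc k) - node c k \<in> ?U" using that l by (intro vec.span_diff nodeU) auto
    then have "snd (snd c) k *s P c k \<in> ?U" by simp
    then have "(1 / snd (snd c) k) *s (snd (snd c) k *s P c k) \<in> ?U" by (rule vec.span_scale)
    then show ?thesis using node(4)[OF that] by simp
  qed
  have allU: "y \<in> ?U" for y
  proof -
    have "card (insert None (Some ` K)) = CARD('n)" using K(1) by (simp add: card_image) (simp add: K_def)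
    from interp_1_expand[OF _ c(2) this, of y] K(1)
    obtain d where y: "y = (\<Sum>i\<in>insert None (Some ` K). d i *s (case i of None \<Rightarrow> fst c | Some k \<Rightarrow> P c k))"
      by auto
    have "fst c \<in> ?U" using nodeU[of 0] l by simp
    then show ?thesis unfolding y
      using PU K(3) by (intro vec.span_sum vec.span_scale) (auto split: option.split)
  qed
  have "inv y" if "q y \<noteq> 0" for y
  proof (rule inv_span[OF pr base])
    show "finite S" by (simp add: S_def)
    show "inv s \<and> q s \<noteq> 0 \<and> b s p \<noteq> 0 \<and> b s r \<noteq> 0" if "s \<in> S" for s
      using that node inv_node[of c] by (auto simp: S_def p_def r_def)
  qed (use that allU in auto)
  then have "rel y0 y1" using rel_all Y(3) f(3) g(4) by blast
  then show False using f(4) g(3,5) by (simp add: rel_def)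
qed

end

section \<open>Maximal rank in one degree\<close>

context quadric
begin

lemma chain_generic:
  assumes "CARD('n) \<ge> 2" "t \<ge> 2" "CARD('n) - 1 \<le> j"
    and Y: "finite Y" "2 * j \<le> card Y" "\<And>y. y \<in> Y \<Longrightarrow> q y = 0" "interp t Y (\<lambda>y. y)"
  shows "gen (\<lambda>c. interp t ({..<j} \<times> UNIV) (pt c))"
  using assms(3) Y(2)
proof (induction j rule: dec_induct)
  case base
  show ?case by (rule star_interp) (use assms(1,2) in auto)
next
  case (step j)
  show ?case by (rule chain_step[OF step.IH _ _ Y(1) _ Y(3,4)]) (use step assms(1) in auto)
qed

text \<open>Let \<open>M\<close> be the largest number, at most \<open>2 * d\<close>, of independent
  points on the quadric. If \<open>M < 2 * d\<close>, any \<open>M\<close> independent points there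
  already force a form vanishing on them to vanish on the quadric; so it suffices that
  \<open>M\<close> of the \<open>2 * d\<close> points be independent.\<close>

lemma max_rank_generic:
  assumes n: "CARD('n) \<ge> 2" "CARD('n) - 1 \<le> d" and t: "t \<ge> 2"
  shows "\<exists>I \<subseteq> {..<d} \<times> UNIV. gen (\<lambda>c. interp t I (pt c)) \<and> (I = {..<d} \<times> UNIV \<or>
    (\<forall>v f. interp t I v \<longrightarrow> (\<forall>i\<in>I. q (v i) = 0) \<longrightarrow> form t f \<longrightarrow> (\<forall>i\<in>I. f (v i) = 0) \<longrightarrow>
      (\<forall>x. q x = 0 \<longrightarrow> f x = 0)))"
proof -
  define E where "E m \<longleftrightarrow> (\<exists>Y. finite Y \<and> card Y = m \<and> (\<forall>y\<in>Y. q y = 0) \<and> interp t Y (\<lambda>y. y))" for m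
  have E_pts: "E (card I)" if "finite I" "interp t I v" "\<And>i. i \<in> I \<Longrightarrow> q (v i) = 0" for I :: "(nat \<times> bool) set" and v
    unfolding E_def using that interp_inj[OF that(2)] interp_image[OF that(2)]
    by (intro exI[of _ "v ` I"]) (auto simp: card_image)
  define Ms where "Ms = {m. m \<le> 2 * d \<and> E m}"
  define M where "M = Max Ms"
  have fin: "finite Ms" by (rule finite_subset[of _ "{..2 * d}"]) (auto simp: Ms_def)
  have "card {..<CARD('n) - 1} < CARD('n)" by simp
  from gen_ex[OF star_interp[OF _ this t]]
  obtain c0 where "interp t ({..<CARD('n) - 1} \<times> UNIV) (pt c0)" by auto
  from E_pts[OF _ this] have "E (2 * (CARD('n) - 1))" by (simp add: q_pt card_cartesian_product mult.commute)
  then have m0: "2 * (CARD('n) - 1) \<in> Ms" using n by (simp add: Ms_def)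
  then have M: "M \<in> Ms" "2 * (CARD('n) - 1) \<le> M" unfolding M_def using fin Max_in Max_ge by blast+
  obtain Y where Y: "finite Y" "card Y = M" "\<And>y. y \<in> Y \<Longrightarrow> q y = 0" "interp t Y (\<lambda>y. y)"
    using M(1) by (auto simp: Ms_def E_def)
  have spanning: "f x = 0"
    if I: "finite I" "card I = M" "M < 2 * d" and v: "interp t I v" "\<forall>i\<in>I. q (v i) = 0"
      and f: "form t f" "\<forall>i\<in>I. f (v i) = 0" "q x = 0" for I :: "(nat \<times> bool) set" and v f x
  proof (rule ccontr)
    assume "f x \<noteq> 0"
    moreover have "x \<notin> v ` I" using f \<open>f x \<noteq> 0\<close> by auto
    ultimately have "interp t (insert x (v ` I)) (\<lambda>y. y)"
      using interp_insert[OF interp_image[OF v(1)] _ f(1), of x] f(2) by auto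
    moreover have "card (insert x (v ` I)) = Suc M"
      using I \<open>x \<notin> v ` I\<close> interp_inj[OF v(1)] by (simp add: card_image)
    ultimately have "E (Suc M)" unfolding E_def using I(1) v(2) f(3)
      by (intro exI[of _ "insert x (v ` I)"]) auto
    then have "Suc M \<in> Ms" using I(3) by (simp add: Ms_def)
    then have "Suc M \<le> M" unfolding M_def using fin Max_ge by blast
    then show False by simp
  qed
  define j where "j = M div 2"
  have j: "CARD('n) - 1 \<le> j" "2 * j \<le> M" using M(2) by (auto simp: j_def)
  have gj: "gen (\<lambda>c. interp t ({..<j} \<times> UNIV) (pt c))"
    using chain_generic[OF n(1) t j(1) Y(1) _ Y(3,4)] j(2) Y(2) by simp
  have cj: "card ({..<j} \<times> (UNIV :: bool set)) = 2 * j" by (simp add: card_cartesian_product)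
  have Md: "M \<le> 2 * d" using M(1) by (simp add: Ms_def)
  show ?thesis
  proof (cases "M = 2 * d")
    case True
    then have "j = d" by (simp add: j_def)
    then show ?thesis using gj by (intro exI[of _ "{..<d} \<times> UNIV"]) auto
  next
    case False
    then have M2: "M < 2 * d" using Md by simp
    then have jd: "j < d" by (simp add: j_def)
    have "\<exists>I \<subseteq> {..<d} \<times> (UNIV :: bool set). gen (\<lambda>c. interp t I (pt c)) \<and> finite I \<and> card I = M"
    proof (cases "even M")
      case True
      then have "2 * j = M" by (simp add: j_def)
      then show ?thesis using gj cj jd by (intro exI[of _ "{..<j} \<times> UNIV"]) auto
    next
      case False
      then have jM: "Suc (2 * j) = M" unfolding j_def by presburger
      \<comment> \<open>For odd \<open>M\<close>, one point of line \<open>j\<close> is added;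
        changing its parameter leaves all earlier points fixed.\<close>
      let ?I = "insert (j, False) ({..<j} \<times> UNIV)"
      obtain c where c: "interp t ({..<j} \<times> UNIV) (pt c)" using gen_ex[OF gj] by blast
      have "card ({..<j} \<times> (UNIV :: bool set)) < card Y" using cj jM Y(2) by simp
      from interp_exchange[OF _ Y(1) this Y(4), of "pt c"]
      obtain f y where f: "form t f" "\<forall>i\<in>{..<j} \<times> UNIV. f (pt c i) = 0" "y \<in> Y" "f y \<noteq> 0" by auto
      obtain z where z: "f (psi z) \<noteq> 0" using psi_dense[OF polyfun_form[OF f(1)] Y(3)[OF f(3)] f(4)] by blast
      define c' where "c' = (fst c, (fst (snd c))(j := z), snd (snd c))"
      have nc: "node c' k = node c k" if "k \<le> j" for k
        by (rule node_cong) (use that in \<open>auto simp: c'_def P_def\<close>)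
      have ptc: "pt c' i = pt c i" if "i \<in> {..<j} \<times> UNIV" for i
        using that nc[of "fst i"] by (auto simp: pt_def R_def) (auto simp: P_def c'_def)
      have c'j: "pt c' (j, False) = psi z" by (simp add: pt_def P_def c'_def)
      have c': "interp t ({..<j} \<times> UNIV) (pt c')" 
        by (rule iffD2[OF interp_cong[OF ptc] c])
      have "interp t ?I (pt c')"
        by (rule interp_insert[OF c' _ f(1)]) (use f(2) z in \<open>auto simp: ptc c'j\<close>)
      then have "gen (\<lambda>c. interp t ?I (pt c))" by (intro genI[OF zopen_interp_pt, of _ _ c']) auto
      moreover have "card ?I = M" using cj jM by simp
      ultimately show ?thesis using jd by (intro exI[of _ ?I]) auto
    qed
    then obtain I where I: "I \<subseteq> {..<d} \<times> UNIV" "gen (\<lambda>c. interp t I (pt c))" "finite I" "card I = M" by blast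
    then show ?thesis using spanning[OF I(3,4) M2] by (intro exI[of _ I]) blast
  qed
qed

section \<open>Incidences of the lines\<close>

lemma gen_skew:
  assumes "CARD('n) \<ge> 4" "i + 2 \<le> j"
  shows "gen (\<lambda>c. interp 1 {..<4} (\<lambda>m. [node c i, P c i, node c j, P c j] ! m))"
proof -
  obtain x where "interp 1 {..<CARD('n)} (\<lambda>i. psi (x i))" using isotropic_basis by blast
  then have x: "interp 1 {..<4} (\<lambda>i. psi (x i))" by (rule interp_mono) (use assms(1) in auto)
  \<comment> \<open>The only move, by \<open>psi (x 2)\<close>, occurs on line \<open>Suc i\<close>,
    which lies strictly between lines \<open>i\<close> and \<open>j\<close>.\<close>
  define c where "c = (psi (x 0), (\<lambda>k. if k = i then x 1 else if k = Suc i then x 2 else x 3),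
     (\<lambda>k. if k = Suc i then 1 else 0 :: complex))"
  have node: "node c k = (if k \<le> Suc i then psi (x 0) else psi (x 0) + psi (x 2))" for k
    by (induction k) (auto simp: c_def P_def)
  have P: "P c i = psi (x 1)" "P c j = psi (x 3)" using assms(2) by (auto simp: P_def c_def)
  have "interp 1 {..<4} (\<lambda>m. [node c i, P c i, node c j, P c j] ! m)"
    unfolding interp_def
  proof
    fix g
    obtain f where f: "form 1 f" "\<And>m. m \<in> {..<4} \<Longrightarrow> f (psi (x m)) = (g(2 := g 2 - g 0)) m"
      using interpE[OF x, of "g(2 := g 2 - g 0)"] by blast
    have "f ([node c i, P c i, node c j, P c j] ! m) = g m" if "m < 4" for m
    proof -
      have "m \<in> {0, 1, 2, 3}" using that by auto
      then show ?thesis using f(2)[of 0] f(2)[of 1] f(2)[of 2] f(2)[of 3] assms(2)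
        by (auto simp: node P form_1_linear[OF f(1)] numeral_2_eq_2 numeral_3_eq_3)
    qed
    then show "\<exists>f. form 1 f \<and> (\<forall>m\<in>{..<4}. f ([node c i, P c i, node c j, P c j] ! m) = g m)"
      using f(1) by auto
  qed
  moreover have "zopen (\<lambda>c. interp 1 {..<4} (\<lambda>m. [node c i, P c i, node c j, P c j] ! m))"
  proof (rule zopen_interp)
    fix m c c' assume "m \<in> {..<4::nat}"
    then have "m \<in> {0, 1, 2, 3}" by auto
    then show "pcurve (\<lambda>s. [node (lin c c' s) i, P (lin c c' s) i, node (lin c c' s) j, P (lin c c' s) j] ! m)"
      by (auto simp: numeral_2_eq_2 numeral_3_eq_3 intro: poly_intros)
  qed simp
  ultimately show ?thesis by (intro genI)
qed

lemma gen_adjacent: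
  assumes "CARD('n) \<ge> 4"
  shows "gen (\<lambda>c. interp 1 {..<3} (\<lambda>m. [node c i, P c i, P c (Suc i)] ! m))"
proof -
  obtain x where x: "interp 1 {..<CARD('n)} (\<lambda>i. psi (x i))" using isotropic_basis by blast
  define c where "c = (psi (x 0), (\<lambda>k. if k = i then x 1 else x 2), (\<lambda>_ :: nat. 0 :: complex))"
  have node: "node c k = psi (x 0)" for k using node_const[of k c] by (simp add: c_def)
  have P: "P c i = psi (x 1)" "P c (Suc i) = psi (x 2)" by (simp_all add: P_def c_def)
  have "interp 1 {..<3} (\<lambda>m. [node c i, P c i, P c (Suc i)] ! m)"
  proof (rule interp_reindex[OF x, of id])
    show "[node c i, P c i, P c (Suc i)] ! m = psi (x (id m))" if "m \<in> {..<3}" for m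
    proof -
      have "m \<in> {0, 1, 2}" using that by auto
      then show ?thesis by (auto simp: node P numeral_2_eq_2)
    qed
  qed (use assms in auto)
  moreover have "zopen (\<lambda>c. interp 1 {..<3} (\<lambda>m. [node c i, P c i, P c (Suc i)] ! m))"
  proof (rule zopen_interp)
    fix m c c' assume "m \<in> {..<3::nat}"
    then have "m \<in> {0, 1, 2}" by auto
    then show "pcurve (\<lambda>s. [node (lin c c' s) i, P (lin c c' s) i, P (lin c c' s) (Suc i)] ! m)"
      by (auto simp: numeral_2_eq_2 intro: poly_intros)
  qed simp
  ultimately show ?thesis by (intro genI)
qed

definition line :: "'n config \<Rightarrow> nat \<Rightarrow> (complex^'n) set" where
  "line c k = {a *s node c k + d *s P c k | a d. True}"

lemma in_line: "node c k \<in> line c k" "P c k \<in> line c k" "node c (Suc k) \<in> line c k" "pt c (k, bb) \<in> line c k"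
proof -
  have *: "a *s node c k + d *s P c k \<in> line c k" for a d unfolding line_def by blast
  show "node c k \<in> line c k" "P c k \<in> line c k" "node c (Suc k) \<in> line c k"
    using *[of 1 0] *[of 0 1] *[of 1 "snd (snd c) k"] by simp_all
  have "R c k = (- (2 * b (node c k) (P c k))) *s node c k + q (node c k) *s P c k"
    by (simp add: R_def refl_def vec_eq_iff)
  then show "pt c (k, bb) \<in> line c k"
    using *[of 0 1] *[of "- (2 * b (node c k) (P c k))" "q (node c k)"] by (cases bb) (simp_all add: pt_def)
qed

text \<open>Restricted to the line, \<open>q\<close> has no term in \<open>d\<^sup>2\<close> since
  \<open>P c k\<close> is isotropic; its two linear factors give \<open>P c k\<close> and
  \<open>R c k\<close>.\<close>

lemma line_quadric:
  assumes "x \<in> line c k" "q x = 0" "q (node c k) \<noteq> 0"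
  shows "\<exists>bb s. x = s *s pt c (k, bb)"
proof -
  obtain a d where x: "x = a *s node c k + d *s P c k" using assms(1) by (auto simp: line_def)
  let ?o = "node c k" and ?p = "P c k"
  have "a * (a * q ?o + 2 * d * b ?o ?p) = 0"
    using assms(2) unfolding x by (simp add: q_simps b_simps q_P algebra_simps power2_eq_square)
  then consider "a = 0" | "a * q ?o = - (2 * d * b ?o ?p)" by (auto simp: eq_neg_iff_add_eq_0)
  then show ?thesis
  proof cases
    case 1
    then show ?thesis unfolding x by (intro exI[of _ False] exI[of _ d]) (simp add: pt_def)
  next
    case 2
    then have a: "a = - (2 * d * b ?o ?p) / q ?o" using assms(3) by (simp add: field_simps)
    have "x = (d / q ?o) *s R c k"
      unfolding x a R_def refl_def using assms(3) by (simp add: vec_eq_iff field_simps)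
    then show ?thesis by (intro exI[of _ True] exI[of _ "d / q ?o"]) (simp add: pt_def)
  qed
qed

lemma skew_disjoint:
  assumes "interp 1 {..<4} (\<lambda>m. [node c i, P c i, node c j, P c j] ! m)" "x \<in> line c i" "x \<in> line c j"
  shows "x = 0"
proof -
  obtain a d where x1: "x = a *s node c i + d *s P c i" using assms(2) unfolding line_def by blast
  obtain a' d' where x2: "x = a' *s node c j + d' *s P c j" using assms(3) unfolding line_def by blast
  note x = x1 x2
  have *: "\<exists>f. form 1 f \<and> f (node c i) = \<alpha> \<and> f (P c i) = \<beta> \<and> f (node c j) = 0 \<and> f (P c j) = 0" for \<alpha> \<beta>
  proof -
    obtain f where f: "form 1 f"
      "\<And>m. m \<in> {..<4} \<Longrightarrow> f ([node c i, P c i, node c j, P c j] ! m) = [\<alpha>, \<beta>, 0, 0] ! m"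
      using interpE[OF assms(1), of "\<lambda>m. [\<alpha>, \<beta>, 0, 0] ! m"] by blast
    show ?thesis using f(1) f(2)[of 0] f(2)[of 1] f(2)[of 2] f(2)[of 3]
      by (intro exI[of _ f]) (simp add: numeral_2_eq_2 numeral_3_eq_3)
  qed
  obtain f where
    f: "form 1 f" "f (node c i) = 1" "f (P c i) = 0" "f (node c j) = 0" "f (P c j) = 0"
    using *[of 1 0] by blast
  obtain g where
    g: "form 1 g" "g (node c i) = 0" "g (P c i) = 1" "g (node c j) = 0" "g (P c j) = 0"
    using *[of 0 1] by blast
  note lin = form_1_linear[OF f(1)] form_1_linear[OF g(1)]
  have "f x = a" "g x = d" unfolding x(1) by (simp_all only: lin f(2,3) g(2,3)) simp_all
  moreover have "f x = 0" "g x = 0" unfolding x(2) by (simp_all only: lin f(4,5) g(4,5)) simp_all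
  ultimately have "a = 0" "d = 0" by blast+
  then show ?thesis unfolding x(1) by simp
qed

lemma adjacent_meet:
  assumes "interp 1 {..<3} (\<lambda>m. [node c i, P c i, P c (Suc i)] ! m)" "x \<in> line c i" "x \<in> line c (Suc i)"
  shows "\<exists>a. x = a *s node c (Suc i)"
proof -
  obtain a d where x1: "x = a *s node c i + d *s P c i" using assms(2) unfolding line_def by blast
  obtain a' d' where x2: "x = a' *s node c (Suc i) + d' *s P c (Suc i)" using assms(3) unfolding line_def by blast
  note x = x1 x2
  obtain f where f: "form 1 f" "\<And>m. m \<in> {..<3} \<Longrightarrow> f ([node c i, P c i, P c (Suc i)] ! m) = [0, 0, 1] ! m"
    using interpE[OF assms(1), of "\<lambda>m. [0, 0, 1] ! m"] by blast
  have "f (node c i) = 0" "f (P c i) = 0" "f (P c (Suc i)) = 1"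
    using f(2)[of 0] f(2)[of 1] f(2)[of 2] by (simp_all add: numeral_2_eq_2)
  note v = this form_1_linear[OF f(1)]
  have "f x = 0" unfolding x(1) using v by simp
  moreover have "f x = d'" unfolding x(2) using v by simp
  ultimately show ?thesis using x(2) by auto
qed


text \<open>One chain realises finitely many generic conditions: for degrees from \<open>2\<close>
  to \<open>T\<close> the independence of the sets \<open>I t\<close> of
  \<open>max_rank_generic\<close>, and for higher degrees the separation of pairs of points by
  quadrics.\<close>

lemma good_chain:
  assumes n: "CARD('n) \<ge> 4" "CARD('n) - 1 \<le> d"
  obtains c where "\<And>k. q (node c k) \<noteq> 0 \<or> k > d" "\<And>k. k < d \<Longrightarrow> b (node c k) (P c k) \<noteq> 0"
    "\<And>i j x. j < d \<Longrightarrow> i + 2 \<le> j \<Longrightarrow> x \<in> line c i \<Longrightarrow> x \<in> line c j \<Longrightarrow> x = 0"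
    "\<And>i x. Suc i < d \<Longrightarrow> x \<in> line c i \<Longrightarrow> x \<in> line c (Suc i) \<Longrightarrow> \<exists>a. x = a *s node c (Suc i)"
    "\<And>f x. form 1 f \<Longrightarrow> (\<forall>i\<in>{..<d} \<times> UNIV. f (pt c i) = 0) \<Longrightarrow> f x = 0"
    "\<And>t. t \<ge> 2 \<Longrightarrow> interp t ({..<d} \<times> UNIV) (pt c) \<or>
       (\<forall>f. form t f \<longrightarrow> (\<forall>i\<in>{..<d} \<times> UNIV. f (pt c i) = 0) \<longrightarrow> (\<forall>x. q x = 0 \<longrightarrow> f x = 0))"
proof -
  define J where "J = {..<d} \<times> (UNIV :: bool set)"
  have J: "finite J" "card J = 2 * d" by (simp_all add: J_def card_cartesian_product)
  \<comment> \<open>The degree given by \<open>interp_pairs\<close> for \<open>2 * d\<close> points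
    and quadrics.\<close>
  define T where "T = (2 * d - 1) * 2"
  define K where "K = {..<CARD('n) - 1}"
  have K: "finite K" "card K < CARD('n)" "K \<subseteq> {..<d}" using n by (auto simp: K_def)
  have "\<forall>t\<in>{2..T}. \<exists>I. I \<subseteq> J \<and> gen (\<lambda>c. interp t I (pt c)) \<and> (I = J \<or>
    (\<forall>v f. interp t I v \<longrightarrow> (\<forall>i\<in>I. q (v i) = 0) \<longrightarrow> form t f \<longrightarrow> (\<forall>i\<in>I. f (v i) = 0) \<longrightarrow>
      (\<forall>x. q x = 0 \<longrightarrow> f x = 0)))"
    using max_rank_generic[of d] n unfolding J_def by fastforce
  then obtain I where I: "\<forall>t\<in>{2..T}. I t \<subseteq> J \<and> gen (\<lambda>c. interp t (I t) (pt c)) \<and> (I t = J \<or>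
    (\<forall>v f. interp t (I t) v \<longrightarrow> (\<forall>i\<in>I t. q (v i) = 0) \<longrightarrow> form t f \<longrightarrow> (\<forall>i\<in>I t. f (v i) = 0) \<longrightarrow>
      (\<forall>x. q x = 0 \<longrightarrow> f x = 0)))"
    by (rule bchoice[THEN exE])
  have "gen (\<lambda>c. (\<forall>k\<in>{..d}. q (node c k) \<noteq> 0) \<and> (\<forall>k\<in>{..<d}. b (node c k) (P c k) \<noteq> 0) \<and>
     (\<forall>(i, j)\<in>{(i, j). i + 2 \<le> j \<and> j < d}. interp 1 {..<4} (\<lambda>m. [node c i, P c i, node c j, P c j] ! m)) \<and>
     (\<forall>i\<in>{..<d}. interp 1 {..<3} (\<lambda>m. [node c i, P c i, P c (Suc i)] ! m)) \<and>
     interp 1 (insert None (Some ` K)) (\<lambda>i. case i of None \<Rightarrow> fst c | Some k \<Rightarrow> P c k) \<and>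
     (\<forall>(i, j)\<in>{..<d} \<times> {..<d}. interp 2 ({i, j} \<times> UNIV) (pt c)) \<and>
     (\<forall>t\<in>{2..T}. interp t (I t) (pt c)))"
  proof (intro gen_conj gen_ball gen_node gen_basis K(1,2) finite_lessThan finite_atMost finite_atLeastAtMost
      gen_adjacent n(1))
    show "finite {(i, j). i + 2 \<le> j \<and> j < d}"
      by (rule finite_subset[of _ "{..<d} \<times> {..<d}"]) auto
    show "gen (\<lambda>c. case p of (i, j) \<Rightarrow> interp 1 {..<4} (\<lambda>m. [node c i, P c i, node c j, P c j] ! m))"
      if "p \<in> {(i, j). i + 2 \<le> j \<and> j < d}" for p
      using that gen_skew[OF n(1)] by (cases p) auto
    show "finite ({..<d} \<times> {..<d})" by simp
    show "gen (\<lambda>c. case p of (i, j) \<Rightarrow> interp 2 ({i, j} \<times> UNIV) (pt c))" for p :: "nat \<times> nat"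
    proof (cases p)
      case (Pair i j)
      have "card {i, j} \<le> 2" by (simp add: card_insert_if)
      then show ?thesis unfolding Pair prod.case using n(1) by (intro star_interp) auto
    qed
    show "gen (\<lambda>c. interp t (I t) (pt c))" if "t \<in> {2..T}" for t using I that by blast
  qed
  from gen_ex[OF this] obtain c where
    c1: "\<forall>k\<in>{..d}. q (node c k) \<noteq> 0" and c2: "\<forall>k\<in>{..<d}. b (node c k) (P c k) \<noteq> 0" and
    c3: "\<forall>(i, j)\<in>{(i, j). i + 2 \<le> j \<and> j < d}. interp 1 {..<4} (\<lambda>m. [node c i, P c i, node c j, P c j] ! m)" and
    c4: "\<forall>i\<in>{..<d}. interp 1 {..<3} (\<lambda>m. [node c i, P c i, P c (Suc i)] ! m)" and
    c5: "interp 1 (insert None (Some ` K)) (\<lambda>i. case i of None \<Rightarrow> fst c | Some k \<Rightarrow> P c k)" and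
    c6: "\<forall>(i, j)\<in>{..<d} \<times> {..<d}. interp 2 ({i, j} \<times> UNIV) (pt c)" and
    c7: "\<forall>t\<in>{2..T}. interp t (I t) (pt c)"
    by (elim exE conjE) (rule that)
  have pt0: "pt c i \<noteq> 0" if "i \<in> J" for i
  proof
    assume "pt c i = 0"
    moreover have "b (P c (fst i)) (R c (fst i)) \<noteq> 0" using c2 that by (auto simp: b_P_R J_def)
    ultimately show False by (auto simp: pt_def b_simps split: if_splits)
  qed
  have TJ: "interp T J (pt c)" unfolding T_def J(2)[symmetric]
  proof (rule interp_pairs[OF J(1)])
    fix i j assume "i \<in> J" "j \<in> J"
    then have "interp 2 ({fst i, fst j} \<times> UNIV) (pt c)" using c6 by (auto simp: J_def)
    then show "interp 2 {i, j} (pt c)" by (rule interp_mono) (auto simp: mem_Times_iff)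
  qed
  have large: "interp t J (pt c)" if "t \<ge> T" for t
    using that by (induction t rule: dec_induct) (auto intro!: interp_Suc TJ J(1) pt0)
  show ?thesis
  proof (rule that[of c])
    show "q (node c k) \<noteq> 0 \<or> k > d" for k using c1 by (cases "k \<le> d") auto
    show "b (node c k) (P c k) \<noteq> 0" if "k < d" for k using c2 that by auto
    show "x = 0" if "j < d" "i + 2 \<le> j" "x \<in> line c i" "x \<in> line c j" for i j x
      using skew_disjoint[OF _ that(3,4)] c3 that(1,2) by auto
    show "\<exists>a. x = a *s node c (Suc i)" if "Suc i < d" "x \<in> line c i" "x \<in> line c (Suc i)" for i x
      using adjacent_meet[OF _ that(2,3)] c4 that(1) by auto
    show "f x = 0" if f: "form 1 f" "\<forall>i\<in>{..<d} \<times> UNIV. f (pt c i) = 0" for f x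
    proof -
      have fP: "f (P c k) = 0" and fR: "f (R c k) = 0" if "k < d" for k
        using f(2) that by (auto simp: pt_simps[symmetric])
      have "0 < d" using n by simp
      \<comment> \<open>The starting node is a combination of the two points of line
        \<open>0\<close>.\<close>
      then have f0: "f (fst c) = 0"
        using fP[of 0] fR[of 0] bspec[OF c2, of 0] by (simp add: R_def refl_def form_1_linear[OF f(1)])
      show ?thesis
      proof (rule interp_1_eq_0[OF _ c5 _ f(1)])
        show "card (insert None (Some ` K)) = CARD('n)" using K(1) by (simp add: card_image) (simp add: K_def)
        fix i assume "i \<in> insert None (Some ` K)"
        then show "f (case i of None \<Rightarrow> fst c | Some k \<Rightarrow> P c k) = 0"
          using f0 fP K(3) by (cases i) auto
      qed (use K(1) in simp)
    qed
    show "interp t ({..<d} \<times> UNIV) (pt c) \<or>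
       (\<forall>f. form t f \<longrightarrow> (\<forall>i\<in>{..<d} \<times> UNIV. f (pt c i) = 0) \<longrightarrow> (\<forall>x. q x = 0 \<longrightarrow> f x = 0))" if "t \<ge> 2" for t
    proof (cases "t \<le> T")
      case True
      then have t: "t \<in> {2..T}" using that by simp
      then have It: "I t \<subseteq> J" "interp t (I t) (pt c)" using I c7 by blast+
      from I t have "I t = J \<or> (\<forall>v f. interp t (I t) v \<longrightarrow> (\<forall>i\<in>I t. q (v i) = 0) \<longrightarrow> form t f \<longrightarrow>
          (\<forall>i\<in>I t. f (v i) = 0) \<longrightarrow> (\<forall>x. q x = 0 \<longrightarrow> f x = 0))" by blast
      then show ?thesis
      proof
        assume "I t = J"
        then show ?thesis using It(2) unfolding J_def by simp
      next
        assume *: "\<forall>v f. interp t (I t) v \<longrightarrow> (\<forall>i\<in>I t. q (v i) = 0) \<longrightarrow> form t f \<longrightarrow>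
          (\<forall>i\<in>I t. f (v i) = 0) \<longrightarrow> (\<forall>x. q x = 0 \<longrightarrow> f x = 0)"
        show ?thesis
        proof (intro disjI2 allI impI)
          fix f x assume f: "form t f" "\<forall>i\<in>{..<d} \<times> UNIV. f (pt c i) = 0" "q x = 0"
          have "\<forall>i\<in>I t. f (pt c i) = 0" using f(2) It(1) unfolding J_def by blast
          then show "f x = 0" using *[rule_format, OF It(2) q_pt f(1) _ f(3)] by blast
        qed
      qed
    next
      case False
      then show ?thesis using large[of t] unfolding J_def by simp
    qed
  qed
qed

section \<open>From configurations to bamboos\<close>

lemma interp_representatives:
  assumes Z: "\<And>x. x \<in> Z \<Longrightarrow> \<exists>i\<in>I. \<exists>a. x = a *s v i" and I: "interp t I v" and S: "representatives Z S"
  shows "\<exists>f. form t f \<and> (\<forall>s\<in>S. f s = g s)"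
proof -
  have SZ: "s \<in> Z" "s \<noteq> 0" if "s \<in> S" for s using S that unfolding representatives_def by blast+
  have "\<forall>s\<in>S. \<exists>ia. fst ia \<in> I \<and> s = snd ia *s v (fst ia)" using Z SZ by fastforce
  then obtain h where h: "\<forall>s\<in>S. fst (h s) \<in> I \<and> s = snd (h s) *s v (fst (h s))" by (rule bchoice[THEN exE])
  define \<iota> where "\<iota> s = fst (h s)" for s
  define a where "a s = snd (h s)" for s
  have h: "\<iota> s \<in> I" "a s *s v (\<iota> s) = s" if "s \<in> S" for s using h that unfolding \<iota>_def a_def by metis+
  have a0: "a s \<noteq> 0" if "s \<in> S" for s using h(2)[OF that] SZ[OF that] by auto
  have inj: "inj_on \<iota> S"
  proof (rule inj_onI)
    fix s s' assume s: "s \<in> S" "s' \<in> S" "\<iota> s = \<iota> s'"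
    have "(a s / a s') *s s' = (a s / a s') *s (a s' *s v (\<iota> s'))" by (simp only: h(2)[OF s(2)])
    also have "\<dots> = a s *s v (\<iota> s)" using a0[OF s(2)] s(3) by simp
    finally have "s = (a s / a s') *s s'" unfolding h(2)[OF s(1)] by simp
    moreover have "s = 1 *s s" by simp
    moreover have "\<exists>!r. r \<in> S \<and> (\<exists>c. s = c *s r)"
      using S SZ[OF s(1)] unfolding representatives_def by blast
    ultimately show "s = s'" using s(1,2) by blast
  qed
  \<comment> \<open>A representative is an arbitrary multiple of its point, so the prescribed value
    is divided by the \<open>t\<close>-th power of the scalar.\<close>
  obtain f where f: "form t f" "\<And>i. i \<in> I \<Longrightarrow> f (v i) = g (inv_into S \<iota> i) / a (inv_into S \<iota> i) ^ t"
    using interpE[OF I, of "\<lambda>i. g (inv_into S \<iota> i) / a (inv_into S \<iota> i) ^ t"] by blast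
  have "f s = g s" if "s \<in> S" for s
  proof -
    have "f s = a s ^ t * f (v (\<iota> s))" using form_homogeneous[OF f(1), of "a s" "v (\<iota> s)"] h(2)[OF that] by simp
    also have "\<dots> = g s" using f(2)[OF h(1)[OF that]] inj a0[OF that] that by simp
    finally show ?thesis .
  qed
  then show ?thesis using f(1) by blast
qed

lemma ex_bamboo:
  assumes n: "CARD('n) \<ge> 4" "CARD('n) - 1 \<le> d"
  shows "\<exists>L. bamboo d L \<and> transversal A d L \<and> max_rank_in_quadric A (curve_of d L \<inter> quadric_cone A)"
proof (rule good_chain[OF n])
  fix c assume c: "\<And>k. q (node c k) \<noteq> 0 \<or> k > d" "\<And>k. k < d \<Longrightarrow> b (node c k) (P c k) \<noteq> 0"
    and skew: "\<And>i j x. j < d \<Longrightarrow> i + 2 \<le> j \<Longrightarrow> x \<in> line c i \<Longrightarrow> x \<in> line c j \<Longrightarrow> x = 0"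
    and adj: "\<And>i x. Suc i < d \<Longrightarrow> x \<in> line c i \<Longrightarrow> x \<in> line c (Suc i) \<Longrightarrow> \<exists>a. x = a *s node c (Suc i)"
    and t1: "\<And>f x. form 1 f \<Longrightarrow> (\<forall>i\<in>{..<d} \<times> UNIV. f (pt c i) = 0) \<Longrightarrow> f x = 0"
    and t2: "\<And>t. t \<ge> 2 \<Longrightarrow> interp t ({..<d} \<times> UNIV) (pt c) \<or>
       (\<forall>f. form t f \<longrightarrow> (\<forall>i\<in>{..<d} \<times> UNIV. f (pt c i) = 0) \<longrightarrow> (\<forall>x. q x = 0 \<longrightarrow> f x = 0))"
  have d: "d \<ge> 1" using n by simp
  have qn: "q (node c k) \<noteq> 0" if "k \<le> d" for k using c(1)[of k] that by simp
  have node0: "node c k \<noteq> 0" if "k \<le> d" for k using qn[OF that] q_simps(4) by metis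
  have P0: "P c k \<noteq> 0" if "k < d" for k using c(2)[OF that] b_simps by metis
  \<comment> \<open>Distinct lines share at most a node, and the nodes lie off the quadric.\<close>
  have meet: "x = 0" if "i < d" "j < d" "i \<noteq> j" "x \<in> line c i" "x \<in> line c j" "q x = 0" for i j x
  proof -
    have *: "x = 0" if "i < j" "j < d" "x \<in> line c i" "x \<in> line c j" for i j
    proof (cases "j = Suc i")
      case True
      then obtain a where a: "x = a *s node c j" using adj[of i x] \<open>j < d\<close> \<open>x \<in> line c i\<close> \<open>x \<in> line c j\<close> by auto
      have "q (node c j) \<noteq> 0" using qn \<open>j < d\<close> by simp
      then show ?thesis using \<open>q x = 0\<close> unfolding a by (simp add: q_simps)
    next
      case False
      then show ?thesis using skew[of j i x] that by simp
    qed
    show ?thesis using *[of i j] *[of j i] that by (cases "i < j") auto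
  qed
  have bamboo: "bamboo d (line c)"
    unfolding bamboo_def
  proof (intro conjI allI impI d)
    show "proj_line (line c k)" if k: "k < d" for k
      unfolding proj_line_def
    proof (intro exI conjI allI impI)
      fix a e assume z: "a *s node c k + e *s P c k = 0"
      have "b (a *s node c k + e *s P c k) (P c k) = a * b (node c k) (P c k)"
        by (simp add: b_simps q_P flip: q_b)
      then have "a = 0" using c(2)[OF k] unfolding z by (simp add: b_simps)
      then show "a = 0" "e = 0" using z P0[OF k] by simp_all
    qed (simp add: line_def)
    show "inj_on (line c) {..<d}"
    proof (rule inj_onI, rule ccontr)
      fix i j assume "i \<in> {..<d}" "j \<in> {..<d}" "line c i = line c j" "i \<noteq> j"
      then show False using meet[of i j "P c i"] P0[of i] q_P[of c i] in_line(2)[of c i] by auto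
    qed
    fix i j assume ij: "i < d" "j < d"
    have meet1: "proj_meet (line c i) (line c j) \<longleftrightarrow> j \<le> i + 1" if "i \<le> j" "j < d" for i j
    proof
      assume "proj_meet (line c i) (line c j)"
      then obtain x where "x \<noteq> 0" "x \<in> line c i" "x \<in> line c j" by (auto simp: proj_meet_def)
      then show "j \<le> i + 1" using skew[of j i x] that by (metis add_2_eq_Suc' not_less_eq_eq Suc_eq_plus1)
    next
      assume "j \<le> i + 1"
      then have "node c j \<in> line c i" using that in_line(1,3)[of c i] by (cases "j = i") (auto simp: le_Suc_eq)
      then show "proj_meet (line c i) (line c j)"
        unfolding proj_meet_def using node0[of j] in_line(1)[of c j] that by auto
    qed
    have sym: "proj_meet (line c i) (line c j) \<longleftrightarrow> proj_meet (line c j) (line c i)"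
      by (auto simp: proj_meet_def)
    show "proj_meet (line c i) (line c j) \<longleftrightarrow> i \<le> j + 1 \<and> j \<le> i + 1"
    proof (cases "i \<le> j")
      case True
      then show ?thesis using meet1[of i j] ij by auto
    next
      case False
      then show ?thesis using meet1[of j i] sym ij by auto
    qed
  qed
  have on_pt: "\<exists>bb s. x = s *s pt c (k, bb)" if "k < d" "x \<in> line c k" "q x = 0" for k x
    using line_quadric[OF that(2,3)] qn[of k] that(1) by simp
  have trans: "transversal A d (line c)"
    unfolding transversal_def
  proof (intro allI impI ballI conjI)
    fix i p assume i: "i < d" "p \<in> line c i" "p \<noteq> 0 \<and> q p = 0"
    show "p \<notin> line c j" if "j < d" "j \<noteq> i" for j using meet[of i j p] i that by auto
    obtain bb s where p: "p = s *s pt c (i, bb)" using on_pt i by blast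
    \<comment> \<open>The other intersection point of the line is the vector \<open>v\<close>
      outside the tangent hyperplane.\<close>
    have "b (P c i) (R c i) \<noteq> 0" using c(2)[OF i(1)] by (simp add: b_P_R)
    then have "b (pt c (i, bb)) (pt c (i, \<not> bb)) \<noteq> 0" using b_sym[of "R c i" "P c i"] by (cases bb) (simp_all add: pt_def)
    then have "b p (pt c (i, \<not> bb)) \<noteq> 0" using i(3) by (auto simp: p b_simps)
    then show "\<exists>v\<in>line c i. b p v \<noteq> 0" using in_line(4) by blast
  qed
  let ?Z = "curve_of d (line c) \<inter> quadric_cone A"
  have Z_pt: "pt c i \<in> ?Z" if "i \<in> {..<d} \<times> UNIV" for i
    using that in_line(4)[of c "fst i" "snd i"] by (auto simp: curve_of_def quadric_cone_def q_pt)
  have Z: "\<exists>i\<in>{..<d} \<times> UNIV. \<exists>a. x = a *s pt c i" if "x \<in> ?Z" for x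
    using that on_pt by (fastforce simp: curve_of_def quadric_cone_def)
  have "max_rank_in_quadric A ?Z"
    unfolding max_rank_in_quadric_def
  proof
    fix t :: int
    consider "t < 0" | "t = 0" | "t = 1" | \<tau> where "t = int \<tau>" "\<tau> \<ge> 2"
      by (metis One_nat_def int_one_le_iff_zero_less less_2_cases not_less of_nat_0 of_nat_1 pos_int_cases linorder_neqE_linordered_idom)
    then show "(\<forall>f. hom_form t f \<longrightarrow> (\<forall>p\<in>?Z. f p = 0) \<longrightarrow> (\<forall>x\<in>quadric_cone A. f x = 0)) \<or>
      (\<forall>S. representatives ?Z S \<longrightarrow> (\<forall>g. \<exists>f. hom_form t f \<and> (\<forall>s\<in>S. f s = g s)))"
    proof cases
      case 1
      then have "{\<alpha> :: 'n \<Rightarrow> nat. int (sum \<alpha> UNIV) = t} = {}" by (auto simp del: of_nat_sum)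
      then show ?thesis unfolding hom_form_def by auto
    next
      case 2
      have "pt c (0, False) \<in> ?Z" using Z_pt d by auto
      moreover have "f x = f y" if "hom_form 0 f" for f and x y :: "complex^'n"
      proof -
        have f: "form 0 f" using that by (simp add: form_def)
        \<comment> \<open>As \<open>0 ^ 0 = 1\<close>, both values equal \<open>f 0\<close>; forms
          of degree \<open>0\<close> are constant, and one point of \<open>?Z\<close> gives
          injectivity.\<close>
        show ?thesis using form_homogeneous[OF f, of 0 x] form_homogeneous[OF f, of 0 y] by simp
      qed
      ultimately show ?thesis using 2 by metis
    next
      case 3
      have "f x = 0" if "hom_form 1 f" "\<forall>p\<in>?Z. f p = 0" for f x
        using t1[of f x] that Z_pt by (auto simp: form_def)
      then show ?thesis using 3 by blast
    next
      case 4
      have h: "hom_form t f \<longleftrightarrow> form \<tau> f" for f :: "complex^'n \<Rightarrow> complex" using 4 by (simp add: form_def)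
      from t2[OF 4(2)] show ?thesis unfolding h
      proof
        assume "interp \<tau> ({..<d} \<times> UNIV) (pt c)"
        from interp_representatives[OF Z this] show "(\<forall>f. form \<tau> f \<longrightarrow> (\<forall>p\<in>?Z. f p = 0) \<longrightarrow> (\<forall>x\<in>quadric_cone A. f x = 0)) \<or>
      (\<forall>S. representatives ?Z S \<longrightarrow> (\<forall>g. \<exists>f. form \<tau> f \<and> (\<forall>s\<in>S. f s = g s)))" by blast
      next
        assume *: "\<forall>f. form \<tau> f \<longrightarrow> (\<forall>i\<in>{..<d} \<times> UNIV. f (pt c i) = 0) \<longrightarrow> (\<forall>x. q x = 0 \<longrightarrow> f x = 0)"
        have "f x = 0" if "form \<tau> f" "\<forall>p\<in>?Z. f p = 0" "x \<in> quadric_cone A" for f x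
          using *[rule_format, OF that(1)] that(2,3) Z_pt by (auto simp: quadric_cone_def)
        then show "(\<forall>f. form \<tau> f \<longrightarrow> (\<forall>p\<in>?Z. f p = 0) \<longrightarrow> (\<forall>x\<in>quadric_cone A. f x = 0)) \<or>
      (\<forall>S. representatives ?Z S \<longrightarrow> (\<forall>g. \<exists>f. form \<tau> f \<and> (\<forall>s\<in>S. f s = g s)))" by blast
      qed
    qed
  qed
  then show ?thesis using bamboo trans by blast
qed

end

theorem theorem2:
  fixes d rho :: nat and A :: "complex^'n^'n"
  assumes "CARD('n) \<ge> 4"
    and "d \<ge> CARD('n) - 1"
    and "quadric_of_rank A rho"
    and "rho \<ge> 4"
  shows "\<exists>L :: nat \<Rightarrow> (complex^'n) set.
           bamboo d L \<and> transversal A d L \<and>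
           max_rank_in_quadric A (curve_of d L \<inter> quadric_cone A)"
proof -
  have A: "transpose A = A" "rank A \<ge> 3" using assms(3,4) by (auto simp: quadric_of_rank_def)
  interpret symmetric_form A by unfold_locales (rule A(1))
  obtain e1 e2 e3 where e: "bform A e1 e1 = 1" "bform A e2 e2 = 1" "bform A e3 e3 = 1"
      "bform A e1 e2 = 0" "bform A e1 e3 = 0" "bform A e2 e3 = 0"
    using ex_orthonormal3[OF A(2)] by blast
  interpret quadric A e1 e2 e3 by unfold_locales (fact e)+
  show ?thesis using ex_bamboo assms(1,2) by blast
qed

end
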